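(* Let $k, d$ be integers with $k \ge 2$ and $d \ge 4k^2 - 2k + 1$. Assume there exists a $d$-dimensional minimal cubature formula of degree $4k+1$, with point set $X \subset \mathbb{R}^d$, for a spherically symmetric integral. Then there exists a layer $X_l$ of $X$ such that every $\alpha \in A(X_l)$ is a rational number.
   Context: Spherically symmetric integral: let $0 \le p < q \le \infty$, $\Omega = \{x \in \mathbb{R}^d : p \le \|x\| < q\}$, and let $W(\|x\|)$ be a positive weight function on $\Omega$ depending only on $\|x\|$. The integral is $$\mathcal{I}[f] = \int_\Omega f(x) W(\|x\|)\,dx = \int_p^q \Big(\int_{S^{d-1}} f(rx)\,d\rho(x)\Big) r^{d-1} W(r)\,dr,$$ where $\rho$ is the surface measure on the unit sphere $S^{d-1}$. For polynomials $f$ it is understood as the iterated integral on the right, and the radial moments $\int_p^q r^{j} r^{d-1} W(r)\,dr$, $0 \le j \le 4k$, are assumed finite (the inner spherical integral of an odd-degree homogeneous polynomial is $0$, so $\mathcal I[f]$ is then defined for all polynomials of degree at most $4k+1$). Cubature formula of degree $t$: a finite set $X \subset \mathbb{R}^d$ of distinct points (not required to lie in $\Omega$) with positive weights $w(x)$, $x \in X$, such that $\mathcal{I}[f] = \sum_{x \in X} w(x) f(x)$ for all polynomials $f$ of degree at most $t$. Let $\mathcal{P}^*_{2k}(\Omega)$ be the space of even polynomials (polynomials $f$ with $f(-x)=f(x)$) of degree at most $2k$, restricted to $\Omega$. A cubature formula of degree $4k+1$ for a spherically symmetric integral is minimal if it attains the Möller lower bound, i.e. $0 \in X$ and $|X|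 = 2\dim \mathcal{P}^*_{2k}(\Omega) - 1$. Layers: a layer of $X$ is a nonempty set of the form $X_i = X \cap S^{d-1}_{r_i}$ with $r_i > 0$, where $S^{d-1}_{r}$ is the sphere of radius $r$ centered at the origin. For a layer $X_i$ of radius $r_i$, $A(X_i) = \{\langle x, y\rangle / r_i^2 : x, y \in X_i,\ x \ne y\}$. *)

theory Defs
  imports "HOL-Analysis.Analysis" "HOL-Library.Function_Algebras"
begin

interpretation real_fun: vector_space "\<lambda>(c::real) (f::'a \<Rightarrow> real) x. c * f x"
  by standard (auto simp: fun_eq_iff algebra_simps)

definition monomial_fun :: "('d \<Rightarrow> nat) \<Rightarrow> real ^ 'd \<Rightarrow> real" where
  "monomial_fun m x = (\<Prod>i\<in>UNIV. (x $ i) ^ m i)"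

text \<open>Polynomials are represented by the functions they induce, which is faithful over the reals.\<close>

definition polys_upto :: "nat \<Rightarrow> (real ^ 'd \<Rightarrow> real) set" where
  "polys_upto t = real_fun.span (monomial_fun ` {m. (\<Sum>i\<in>UNIV. m i) \<le> t})"

text \<open>The restriction of a function to \<open>\<Omega>\<close> is represented by its extension by zero,
  so that restrictions are equal iff they agree on \<open>\<Omega>\<close>.\<close>

definition restrict_zero :: "'a set \<Rightarrow> ('a \<Rightarrow> real) \<Rightarrow> 'a \<Rightarrow> real" where
  "restrict_zero \<Omega> f = (\<lambda>x. if x \<in> \<Omega> then f x else 0)"

definition even_polys_on :: "(real ^ 'd) set \<Rightarrow> nat \<Rightarrow> (real ^ 'd \<Rightarrow> real) set" where
  "even_polys_on \<Omega> t = restrict_zero \<Omega> ` {f \<in> polys_upto t. \<forall>x. f (- x) = f x}"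

definition annulus :: "real \<Rightarrow> ereal \<Rightarrow> (real ^ 'd) set" where
  "annulus p q = {x. p \<le> norm x \<and> ereal (norm x) < q}"

text \<open>The surface measure on the unit sphere, as the cone measure: \<open>d\<close> times the image of
  Lebesgue measure on the punctured unit ball under radial projection
  (see \<open>emeasure_sphere_measure\<close> below).\<close>

definition sphere_measure :: "(real ^ 'd) measure" where
  "sphere_measure = scale_measure (of_nat CARD('d))
     (distr (restrict_space lborel (cball 0 1 - {0})) (restrict_space borel (sphere 0 1))
        (\<lambda>x. x /\<^sub>R norm x))"

lemma space_sphere_measure [simp]: "space sphere_measure = sphere 0 1"
  by (simp add: sphere_measure_def space_scale_measure space_restrict_space)

lemma sets_sphere_measure [simp, measurable_cong]:
  "sets sphere_measure = sets (restrict_space borel (sphere 0 1))"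
  by (simp add: sphere_measure_def)

lemma emeasure_sphere_measure:
  fixes A :: "(real ^ 'd) set"
  assumes "A \<in> sets borel" "A \<subseteq> sphere 0 1"
  shows "emeasure sphere_measure A =
    of_nat CARD('d) * emeasure lborel {r *\<^sub>R x | r x. 0 < r \<and> r \<le> 1 \<and> x \<in> A}"
proof -
  let ?f = "\<lambda>x :: real ^ 'd. x /\<^sub>R norm x"
  let ?M = "restrict_space lborel (cball 0 1 - {0 :: real ^ 'd})"
  have f: "?f \<in> ?M \<rightarrow>\<^sub>M restrict_space borel (sphere 0 1)"
    by (intro measurable_restrict_space2 measurable_restrict_space1)
       (auto simp: space_restrict_space)
  have A: "A \<in> sets (restrict_space borel (sphere 0 1))"
    using assms by (auto simp: sets_restrict_space_iff)
  have "?f -` A \<inter> space ?M = {r *\<^sub>R x | r x. 0 < r \<and> r \<le> 1 \<and> x \<in> A}"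
  proof (intro equalityI subsetI)
    fix y assume "y \<in> ?f -` A \<inter> space ?M"
    then have "y = norm y *\<^sub>R ?f y" "0 < norm y" "norm y \<le> 1" "?f y \<in> A"
      by (auto simp: space_restrict_space)
    then show "y \<in> {r *\<^sub>R x | r x. 0 < r \<and> r \<le> 1 \<and> x \<in> A}" by blast
  next
    fix y assume "y \<in> {r *\<^sub>R x | r x. 0 < r \<and> r \<le> 1 \<and> x \<in> A}"
    then obtain r x where *: "y = r *\<^sub>R x" "0 < r" "r \<le> 1" "x \<in> A" by blast
    moreover have "norm x = 1" using * assms(2) by auto
    moreover have "?f y = x" using calculation by (simp add: field_simps)
    ultimately show "y \<in> ?f -` A \<inter> space ?M"
      by (auto simp: space_restrict_space)
  qed
  moreover have "emeasure ?M (?f -` A \<inter> space ?M) = emeasure lborel (?f -` A \<inter> space ?M)"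
    by (intro emeasure_restrict_space) (auto simp: space_restrict_space)
  ultimately show ?thesis
    by (simp add: sphere_measure_def emeasure_distr[OF f A])
qed

text \<open>The integral is the iterated one, which is how it is meant for polynomials:
  for odd \<open>f\<close> the inner integral vanishes even if the radial moments of odd order diverge.
  The weight only has to be Lebesgue measurable, hence \<open>lebesgue\<close>.\<close>

definition radial_integral ::
  "real \<Rightarrow> ereal \<Rightarrow> (real \<Rightarrow> real) \<Rightarrow> (real ^ 'd \<Rightarrow> real) \<Rightarrow> real" where
  "radial_integral p q W f =
     (LINT r=ereal p..q|lebesgue.
        ((LINT x|sphere_measure. f (r *\<^sub>R x)) * r ^ (CARD('d) - 1) * W r))"

definition cubature_formula ::
  "((real ^ 'd \<Rightarrow> real) \<Rightarrow> real) \<Rightarrow> nat \<Rightarrow> (real ^ 'd) set \<Rightarrow> (real ^ 'd \<Rightarrow> real) \<Rightarrow> bool" where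
  "cubature_formula I t X w \<longleftrightarrow>
     finite X \<and> (\<forall>x\<in>X. w x > 0) \<and> (\<forall>f\<in>polys_upto t. I f = (\<Sum>x\<in>X. w x * f x))"

definition minimal_cubature ::
  "real \<Rightarrow> ereal \<Rightarrow> (real \<Rightarrow> real) \<Rightarrow> nat \<Rightarrow> (real ^ 'd) set \<Rightarrow> (real ^ 'd \<Rightarrow> real) \<Rightarrow> bool" where
  "minimal_cubature p q W k X w \<longleftrightarrow>
     cubature_formula (radial_integral p q W) (4 * k + 1) X w \<and> 0 \<in> X \<and>
     int (card X) =
       2 * int (real_fun.dim (even_polys_on (annulus p q :: (real ^ 'd) set) (2 * k))) - 1"

definition is_layer :: "(real ^ 'd) set \<Rightarrow> real \<Rightarrow> (real ^ 'd) set \<Rightarrow> bool" where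
  "is_layer X r L \<longleftrightarrow> r > 0 \<and> L = X \<inter> sphere 0 r \<and> L \<noteq> {}"

definition inner_products :: "real \<Rightarrow> (real ^ 'd) set \<Rightarrow> real set" where
  "inner_products r L = {(x \<bullet> y) / r\<^sup>2 | x y. x \<in> L \<and> y \<in> L \<and> x \<noteq> y}"

end

theory Submission
  imports Defs
begin

text \<open>
  Let \<open>V\<close> be the space of even polynomials of degree at most \<open>2k\<close> and \<open>N\<close> its dimension on \<open>\<Omega>\<close>, so that
  \<open>|X| = 2N - 1\<close>. On \<open>V\<close> the integral defines the inner product \<open>\<I>[fg] = \<Sum>w(x) f(x) g(x)\<close>,
  which is definite and invariant under isometries.

  Tightness first makes \<open>X\<close> antipodal. For \<open>f \<in> V\<close> and linear \<open>l\<close> the odd polynomial \<open>l f\<^sup>2\<close> has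
  integral zero, so an \<open>f\<close> that vanishes on the points with \<open>l > 0\<close> also vanishes on those with
  \<open>l < 0\<close>. Taking for \<open>l\<close> a functional whose kernel meets \<open>X\<close> in a single line, and then one
  along that line, shows that half of \<open>X\<close> together with \<open>0\<close> is unisolvent for \<open>V\<close>. Such a half has
  exactly \<open>N\<close> points, hence one can interpolate in it, and the odd moments along the line
  show that \<open>V\<close> contains the indicator on \<open>X\<close> of every pair \<open>{x, -x}\<close> and of \<open>{0}\<close>
  (\<open>antipodal_delta\<close>).

  These indicators are, up to positive factors, the values on \<open>X\<close> of the reproducing kernel
  \<open>K(x, \<cdot>)\<close> at the points of \<open>X\<close>. So \<open>K(x, y) = 0\<close> for \<open>y \<noteq> x, -x\<close>, and \<open>K\<close> is invariant under reflections that keep \<open>x\<close>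
  in \<open>X\<close>. Therefore \<open>K(0, y)\<close> is an even polynomial in \<open>\<parallel>y\<parallel>\<close> of degree at most \<open>2k\<close>, which leaves at most
  \<open>k\<close> layers (\<open>card_radii\<close>); and on one layer \<open>K(x, y)\<close> is an even polynomial in \<open>\<langle>x, y\<rangle>\<close> of degree
  at most \<open>2k\<close>, which leaves at most \<open>k\<close> squares of inner products of non-antipodal points
  (\<open>card_squared_inner_products\<close>).

  Some layer is then large: its half \<open>Y\<close> in an open half space has at least \<open>(N - 1)/k\<close> points. Let \<open>D\<close>
  be the number of monomials of degree \<open>2k - 1\<close>. There are \<open>(d + 2k - 1)/(2k) \<ge> 2k\<close> times as many monomials
  of degree \<open>2k\<close>; this is where \<open>d \<ge> 4k\<^sup>2 - 2k + 1\<close> enters, and it gives \<open>|Y| > 2D\<close>.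

  Finally comes an argument in the style of Larman, Rogers and Seidel. Let \<open>\<beta>\<^sub>1, \<dots>\<close> be the squares of
  the normalised inner products on \<open>Y\<close>, let \<open>\<alpha> \<noteq> 0\<close> be one of the inner products, and put \<open>F(t) = \<Prod>(t\<^sup>2 - \<beta>\<^sub>j)\<close>
  over all \<open>\<beta>\<^sub>j \<noteq> \<alpha>\<^sup>2\<close>. Evaluated at the inner products, \<open>F\<close> gives the matrix \<open>F(1) I + F(\<alpha>) A\<close> with entries
  0 and 1 in \<open>A\<close>, and \<open>t F(t)\<close> gives \<open>F(1) I + \<alpha> F(\<alpha>) S\<close> with entries 0, 1 and -1 in \<open>S\<close>. Both
  matrices have rank at most \<open>D\<close>, being made of homogeneous polynomials of degree \<open>2k - 2\<close> and
  \<open>2k - 1\<close>. So \<open>A\<close> and \<open>S\<close> have eigenvalues \<open>-F(1)/F(\<alpha>)\<close> and \<open>-F(1)/(\<alpha> F(\<alpha>))\<close> of multiplicity more than \<open>|Y|/2\<close>. An eigenvalue of a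
  rational matrix with more than half of the total multiplicity is rational
  (\<open>rational_eigenvalue\<close>), and \<open>\<alpha>\<close> is the quotient of these two numbers.
\<close>

section \<open>Dimension bounds and rational eigenvalues\<close>

definition linear_fun :: "(('a \<Rightarrow> real) \<Rightarrow> real) \<Rightarrow> bool" where
  "linear_fun \<phi> \<longleftrightarrow> (\<forall>u v. \<phi> (\<lambda>x. u x + v x) = \<phi> u + \<phi> v) \<and> (\<forall>c u. \<phi> (\<lambda>x. c * u x) = c * \<phi> u)"

lemma linear_fun_eval [simp]: "linear_fun (\<lambda>v. v a)"
  by (simp add: linear_fun_def)

lemma linear_fun_weighted_sum [simp]: "linear_fun (\<lambda>v. \<Sum>y\<in>Y. v y * g y)"
  by (simp add: linear_fun_def distrib_right sum.distrib sum_distrib_left mult.assoc)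

lemma linear_fun_sum:
  assumes "linear_fun \<phi>" "finite B"
  shows "\<phi> (\<lambda>x. \<Sum>b\<in>B. c b * F b x) = (\<Sum>b\<in>B. c b * \<phi> (F b))"
  using assms(2)
proof (induction B rule: finite_induct)
  case empty
  have "\<And>c u. \<phi> (\<lambda>x. c * u x) = c * \<phi> u"
    using assms(1) unfolding linear_fun_def by blast
  from this[of 0] show ?case by simp
next
  case (insert b B)
  then show ?case using assms(1) by (simp add: linear_fun_def)
qed

text \<open>Gaussian elimination: one equation is solved for a variable and substituted into the others.\<close>

lemma underdetermined_system:
  fixes a :: "'i \<Rightarrow> 'b \<Rightarrow> real"
  assumes "finite I" "finite B" "card I < card B"
  shows "\<exists>c. (\<exists>b\<in>B. c b \<noteq> 0) \<and> (\<forall>i\<in>I. (\<Sum>b\<in>B. c b * a i b) = 0)"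
  using assms
proof (induction I arbitrary: B a rule: finite_induct)
  case empty
  then obtain b where "b \<in> B" by fastforce
  then show ?case by (intro exI[of _ "\<lambda>_. 1"]) auto
next
  case (insert i I)
  show ?case
  proof (cases "\<forall>b\<in>B. a i b = 0")
    case True
    with insert.IH[of B a] insert.prems insert.hyps show ?thesis by simp
  next
    case False
    then obtain b0 where b0: "b0 \<in> B" "a i b0 \<noteq> 0" by blast
    let ?B = "B - {b0}"
    \<comment> \<open>The coefficients of the other equations after the variable \<open>b0\<close> has been eliminated.\<close>
    define a' where "a' = (\<lambda>j b. a j b - a j b0 * a i b / a i b0)"
    have "card I < card ?B" using insert.prems insert.hyps b0 by simp
    then obtain c where c: "\<exists>b\<in>?B. c b \<noteq> 0" "\<forall>j\<in>I. (\<Sum>b\<in>?B. c b * a' j b) = 0"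
      using insert.IH[of ?B a'] insert.prems by auto
    define t where "t = - (\<Sum>b\<in>?B. c b * a i b) / a i b0"
    define c' where "c' = c(b0 := t)"
    have split: "(\<Sum>b\<in>B. c' b * a j b) = t * a j b0 + (\<Sum>b\<in>?B. c b * a j b)" for j
    proof -
      have "(\<Sum>b\<in>B. c' b * a j b) = c' b0 * a j b0 + (\<Sum>b\<in>?B. c' b * a j b)"
        using b0 insert.prems by (simp add: sum.remove)
      also have "(\<Sum>b\<in>?B. c' b * a j b) = (\<Sum>b\<in>?B. c b * a j b)"
        by (intro sum.cong) (auto simp: c'_def)
      finally show ?thesis by (simp add: c'_def)
    qed
    have "(\<Sum>b\<in>B. c' b * a j b) = 0" if "j \<in> insert i I" for j
    proof (cases "j = i")
      case True
      then show ?thesis using b0 by (simp add: split t_def)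
    next
      case False
      then have "0 = (\<Sum>b\<in>?B. c b * a' j b)" using that c by auto
      also have "\<dots> = (\<Sum>b\<in>?B. c b * a j b) - a j b0 / a i b0 * (\<Sum>b\<in>?B. c b * a i b)"
        by (simp add: a'_def right_diff_distrib sum_subtractf sum_distrib_left mult_ac)
      finally show ?thesis by (simp add: split t_def)
    qed
    moreover have "\<exists>b\<in>B. c' b \<noteq> 0" using c(1) by (auto simp: c'_def)
    ultimately show ?thesis by blast
  qed
qed

text \<open>A lower bound for the dimension of \<open>E\<close>, in the form in which it is used: fewer than \<open>m\<close> linear conditions
  have a common nonzero solution in \<open>E\<close>. In this form the bound passes to subspaces cut out
  by further conditions without any choice of bases.\<close>

definition dim_ge :: "nat \<Rightarrow> ('a \<Rightarrow> real) set \<Rightarrow> bool" where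
  "dim_ge m E \<longleftrightarrow> (\<forall>\<Phi>. finite \<Phi> \<longrightarrow> card \<Phi> < m \<longrightarrow> (\<forall>\<phi>\<in>\<Phi>. linear_fun \<phi>) \<longrightarrow>
     (\<exists>v\<in>E. (\<exists>x. v x \<noteq> 0) \<and> (\<forall>\<phi>\<in>\<Phi>. \<phi> v = 0)))"

lemma dim_ge_combinations:
  assumes "finite B" "\<And>c. \<exists>b\<in>B. c b \<noteq> 0 \<Longrightarrow> \<exists>x. (\<Sum>b\<in>B. c b * F b x) \<noteq> 0"
    and "\<And>c. (\<lambda>x. \<Sum>b\<in>B. c b * F b x) \<in> E"
  shows "dim_ge (card B) E"
  unfolding dim_ge_def
proof safe
  fix \<Phi> :: "(('b \<Rightarrow> real) \<Rightarrow> real) set"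
  assume \<Phi>: "finite \<Phi>" "card \<Phi> < card B" "\<forall>\<phi>\<in>\<Phi>. linear_fun \<phi>"
  obtain c where c: "\<exists>b\<in>B. c b \<noteq> 0" "\<forall>\<phi>\<in>\<Phi>. (\<Sum>b\<in>B. c b * \<phi> (F b)) = 0"
    using underdetermined_system[OF \<Phi>(1) assms(1) \<Phi>(2), of "\<lambda>\<phi> b. \<phi> (F b)"] by auto
  then show "\<exists>v\<in>E. (\<exists>x. v x \<noteq> 0) \<and> (\<forall>\<phi>\<in>\<Phi>. \<phi> v = 0)"
    using \<Phi>(3) assms by (intro bexI[of _ "\<lambda>x. \<Sum>b\<in>B. c b * F b x"]) (auto simp: linear_fun_sum)
qed

lemma dim_ge_functions_on:
  assumes "finite Y"
  shows "dim_ge (card Y) {v. \<forall>x. x \<notin> Y \<longrightarrow> v x = 0}"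
proof (rule dim_ge_combinations[OF assms, where F = "\<lambda>y x. if x = y then 1 else 0"])
  fix c :: "'a \<Rightarrow> real" assume "\<exists>b\<in>Y. c b \<noteq> 0"
  then show "\<exists>x. (\<Sum>b\<in>Y. c b * (if x = b then 1 else 0)) \<noteq> 0"
    using assms by (auto simp: if_distrib cong: if_cong)
next
  fix c :: "'a \<Rightarrow> real"
  show "(\<lambda>x. \<Sum>b\<in>Y. c b * (if x = b then 1 else 0)) \<in> {v. \<forall>x. x \<notin> Y \<longrightarrow> v x = 0}"
    using assms by (auto simp: if_distrib cong: if_cong)
qed

lemma dim_ge_kernel:
  assumes "dim_ge m E" "finite \<Psi>" "\<And>\<psi>. \<psi> \<in> \<Psi> \<Longrightarrow> linear_fun \<psi>"
  shows "dim_ge (m - card \<Psi>) {v\<in>E. \<forall>\<psi>\<in>\<Psi>. \<psi> v = 0}"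
  unfolding dim_ge_def
proof safe
  fix \<Phi> :: "(('a \<Rightarrow> real) \<Rightarrow> real) set"
  assume \<Phi>: "finite \<Phi>" "card \<Phi> < m - card \<Psi>" "\<forall>\<phi>\<in>\<Phi>. linear_fun \<phi>"
  have "card (\<Phi> \<union> \<Psi>) < m" using card_Un_le[of \<Phi> \<Psi>] \<Phi>(2) by linarith
  then obtain v where "v \<in> E" "\<exists>x. v x \<noteq> 0" "\<forall>\<phi>\<in>\<Phi> \<union> \<Psi>. \<phi> v = 0"
    using assms(1)[unfolded dim_ge_def, rule_format, of "\<Phi> \<union> \<Psi>"] assms(2,3) \<Phi> by blast
  then show "\<exists>v\<in>{v \<in> E. \<forall>\<psi>\<in>\<Psi>. \<psi> v = 0}. (\<exists>x. v x \<noteq> 0) \<and> (\<forall>\<phi>\<in>\<Phi>. \<phi> v = 0)"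
    by blast
qed

lemma dim_ge_nonzero:
  assumes "dim_ge m E" "m > 0"
  obtains v x where "v \<in> E" "v x \<noteq> 0"
  using assms(1)[unfolded dim_ge_def, rule_format, of "{}"] assms(2) by auto

lemma dim_ge_vanishing:
  assumes "dim_ge m E" "finite S" "card S < m"
  obtains v x where "v \<in> E" "v x \<noteq> 0" "\<And>y. y \<in> S \<Longrightarrow> v y = 0"
proof -
  let ?\<Phi> = "(\<lambda>y (v :: 'a \<Rightarrow> real). v y) ` S"
  have "card ?\<Phi> < m" using assms card_image_le[of S "\<lambda>y (v::'a\<Rightarrow>real). v y"] by simp
  then have "\<exists>v\<in>E. (\<exists>x. v x \<noteq> 0) \<and> (\<forall>\<phi>\<in>?\<Phi>. \<phi> v = 0)"
    using assms(2) by (intro assms(1)[unfolded dim_ge_def, rule_format]) auto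
  then obtain v x where v: "v \<in> E" "v x \<noteq> 0" and S: "\<forall>\<phi>\<in>?\<Phi>. \<phi> v = 0" by auto
  have "v y = 0" if "y \<in> S" for y using bspec[OF S imageI[OF that]] .
  then show ?thesis by (rule that[OF v])
qed

text \<open>An eigenspace of a rational matrix that takes up more than half of the dimension belongs to a rational eigenvalue,
  because an irrational one would have a conjugate of the same multiplicity. The proof avoids field extensions: an off-diagonal
  entry \<open>M i j \<noteq> 0\<close> allows one to restrict to eigenvectors with \<open>v i = 0\<close> and to solve row \<open>i\<close>
  for \<open>v j\<close>. This removes two indices from the matrix and at most one dimension from the eigenspace, so the
  majority persists. When the matrix has become diagonal, the eigenvalue is one of its entries.\<close>

lemma rational_eigenvalue:
  fixes M :: "'a \<Rightarrow> 'a \<Rightarrow> real"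
  assumes "finite Y" "dim_ge m E" "2 * m > card Y"
    and "\<And>x y. x \<in> Y \<Longrightarrow> y \<in> Y \<Longrightarrow> M x y \<in> \<rat>"
    and "\<And>v x. v \<in> E \<Longrightarrow> x \<in> Y \<Longrightarrow> (\<Sum>y\<in>Y. M x y * v y) = l * v x"
    and "\<And>v x. v \<in> E \<Longrightarrow> (\<And>y. y \<in> Y \<Longrightarrow> v y = 0) \<Longrightarrow> v x = 0"
  shows "l \<in> \<rat>"
  using assms
proof (induction "card Y" arbitrary: Y M E m rule: less_induct)
  case less
  note fin = less.prems(1) and E = less.prems(2) and m = less.prems(3)
    and rat = less.prems(4) and eig = less.prems(5) and det = less.prems(6)
  show ?case
  proof (cases "\<exists>i\<in>Y. \<exists>j\<in>Y. i \<noteq> j \<and> M i j \<noteq> 0")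
    case False
    obtain v x where v: "v \<in> E" "v x \<noteq> 0" using dim_ge_nonzero[OF E] m by auto
    then obtain y where y: "y \<in> Y" "v y \<noteq> 0" using det by blast
    have "(\<Sum>z\<in>Y. M y z * v z) = (\<Sum>z\<in>Y. if z = y then M y y * v y else 0)"
      using False y by (intro sum.cong) auto
    also have "\<dots> = M y y * v y" using y fin by simp
    finally have "M y y = l" using eig[OF v(1) y(1)] y by simp
    then show ?thesis using rat y by blast
  next
    case True
    then obtain i j where ij: "i \<in> Y" "j \<in> Y" "i \<noteq> j" "M i j \<noteq> 0" by blast
    let ?Y = "Y - {i,j}"
    \<comment> \<open>The matrix that acts on the remaining coordinates once \<open>v j\<close> has been expressed by them.\<close>
    define M' where "M' = (\<lambda>x y. M x y - M x j * M i y / M i j)"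
    let ?E = "{v\<in>E. \<forall>\<psi>\<in>{\<lambda>v. v i}. \<psi> v = 0}"
    have cardY: "card Y = Suc (Suc (card ?Y))"
      using ij fin by (metis DiffI Diff_insert2 card_Suc_Diff1 finite_Diff singletonD)
    have split: "(\<Sum>y\<in>Y. M x y * v y) = M x j * v j + (\<Sum>y\<in>?Y. M x y * v y)" if "v i = 0" for x v
    proof -
      have "(\<Sum>y\<in>Y. M x y * v y) = M x i * v i + (\<Sum>y\<in>Y-{i}. M x y * v y)"
        using ij fin by (simp add: sum.remove)
      also have "(\<Sum>y\<in>Y-{i}. M x y * v y) = M x j * v j + (\<Sum>y\<in>Y-{i}-{j}. M x y * v y)"
        using ij fin by (intro sum.remove) auto
      also have "Y - {i} - {j} = ?Y" by auto
      finally show ?thesis using that by simp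
    qed
    have vj: "v j = - (\<Sum>y\<in>?Y. M i y * v y) / M i j" if "v \<in> E" "v i = 0" for v
    proof -
      have "M i j * v j + (\<Sum>y\<in>?Y. M i y * v y) = 0"
        using eig[OF that(1) ij(1)] split[of v i, OF that(2)] that(2) by simp
      then have "v j * M i j = - (\<Sum>y\<in>?Y. M i y * v y)" by (simp add: mult.commute)
      then show ?thesis using ij(4) by (metis nonzero_eq_divide_eq)
    qed
    show ?thesis
    proof -
      have 1: "card ?Y < card Y" "finite ?Y" using cardY fin by auto
      have 2: "dim_ge (m - 1) ?E" using dim_ge_kernel[OF E, of "{\<lambda>v. v i}"] by simp
      have 3: "card ?Y < 2 * (m - 1)" using m cardY by linarith
      have 4: "M' x y \<in> \<rat>" if "x \<in> ?Y" "y \<in> ?Y" for x y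
        using that rat ij unfolding M'_def by (intro Rats_diff Rats_divide Rats_mult) auto
      have 5: "(\<Sum>y\<in>?Y. M' x y * v y) = l * v x" if "v \<in> ?E" "x \<in> ?Y" for v x
      proof -
        have v: "v \<in> E" "v i = 0" using that by auto
        have "(\<Sum>y\<in>?Y. M' x y * v y) = (\<Sum>y\<in>?Y. M x y * v y) - M x j / M i j * (\<Sum>y\<in>?Y. M i y * v y)"
          by (simp add: M'_def left_diff_distrib right_diff_distrib sum_subtractf sum_distrib_left mult_ac)
        also have "\<dots> = M x j * v j + (\<Sum>y\<in>?Y. M x y * v y)" unfolding vj[OF v] using ij(4) by simp
        also have "\<dots> = l * v x" using eig[OF v(1), of x] that(2) split[of v x, OF v(2)] by simp
        finally show ?thesis .
      qed
      have 6: "v x = 0" if "v \<in> ?E" "\<And>y. y \<in> ?Y \<Longrightarrow> v y = 0" for v x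
      proof -
        have v: "v \<in> E" "v i = 0" using that by auto
        have "v j = 0" using vj[OF v] that(2) by simp
        then have "\<And>y. y \<in> Y \<Longrightarrow> v y = 0" using that(2) v by blast
        then show ?thesis using det v by blast
      qed
      show ?thesis 
        by (rule less.hyps[where Y = ?Y and m = "m - 1" and E = ?E and M = M', OF 1 2 3]) (fact 4 5 6)+
    qed
  qed
qed

section \<open>Polynomial functions\<close>

lemma span_fun_add: "f \<in> real_fun.span A \<Longrightarrow> g \<in> real_fun.span A \<Longrightarrow> (\<lambda>x. f x + g x) \<in> real_fun.span A"
  using real_fun.span_add[of f A g] by (simp add: plus_fun_def)

lemma span_fun_sum:
  "(\<And>i. i \<in> I \<Longrightarrow> f i \<in> real_fun.span A) \<Longrightarrow> (\<lambda>x. \<Sum>i\<in>I. f i x) \<in> real_fun.span A"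
proof (induction I rule: infinite_finite_induct)
  case (insert i I)
  then show ?case by (simp add: span_fun_add)
qed (use real_fun.span_zero[of A] in \<open>simp_all add: zero_fun_def\<close>)

lemma span_fun_induct [consumes 1, case_names zero scale add]:
  assumes "f \<in> real_fun.span A" "P (\<lambda>_. 0)"
    "\<And>c a. a \<in> A \<Longrightarrow> P (\<lambda>x. c * a x)" "\<And>f g. P f \<Longrightarrow> P g \<Longrightarrow> P (\<lambda>x. f x + g x)"
  shows "P f"
  using assms(1)
proof (induction rule: real_fun.span_induct_alt)
  case base
  then show ?case using assms(2) by (simp add: zero_fun_def)
next
  case (step c a g)
  then show ?case using assms(3)[of a c] assms(4)[of "\<lambda>x. c * a x" g] by (simp add: plus_fun_def)
qed

lemma span_fun_mult:
  assumes "f \<in> real_fun.span A" "g \<in> real_fun.span B"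
    and "\<And>a b. a \<in> A \<Longrightarrow> b \<in> B \<Longrightarrow> (\<lambda>x. a x * b x) \<in> real_fun.span C"
  shows "(\<lambda>x. f x * g x) \<in> real_fun.span C"
proof -
  have "(\<lambda>x. a x * g x) \<in> real_fun.span C" if "a \<in> A" for a
    using assms(2)
  proof (induction rule: span_fun_induct)
    case zero
    then show ?case using real_fun.span_zero by (simp add: zero_fun_def)
  next
    case (scale c b)
    then show ?case using real_fun.span_scale[OF assms(3)[OF that], of b c] by (simp add: mult.left_commute)
  next
    case (add f g)
    then show ?case by (simp add: distrib_left span_fun_add)
  qed
  note * = this
  show ?thesis using assms(1)
  proof (induction rule: span_fun_induct)
    case zero
    then show ?case using real_fun.span_zero by (simp add: zero_fun_def)
  next
    case (scale c b)
    then show ?case using real_fun.span_scale[OF *, of b c] by (simp add: mult.assoc)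
  next
    case (add f g)
    then show ?case by (simp add: distrib_right span_fun_add)
  qed
qed

lemma monomial_fun_mult:
  "monomial_fun m x * monomial_fun m' x = monomial_fun (\<lambda>i. m i + m' i) x"
  by (simp add: monomial_fun_def power_add prod.distrib)

lemma monomial_fun_single: "monomial_fun (\<lambda>j. if j = i then n else 0) x = (x $ i) ^ n"
  unfolding monomial_fun_def by (simp add: if_distrib [where f = "\<lambda>n. _ ^ n"] cong: if_cong)

lemma polys_upto_mono: "f \<in> polys_upto s \<Longrightarrow> s \<le> t \<Longrightarrow> f \<in> polys_upto t"
  unfolding polys_upto_def by (rule subsetD[OF real_fun.span_mono]) auto

lemma polys_upto_add: "f \<in> polys_upto t \<Longrightarrow> g \<in> polys_upto t \<Longrightarrow> (\<lambda>x. f x + g x) \<in> polys_upto t"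
  unfolding polys_upto_def by (rule span_fun_add)

lemma polys_upto_sum: "(\<And>i. i \<in> I \<Longrightarrow> f i \<in> polys_upto t) \<Longrightarrow> (\<lambda>x. \<Sum>i\<in>I. f i x) \<in> polys_upto t"
  unfolding polys_upto_def by (rule span_fun_sum)

lemma polys_upto_scale: "f \<in> polys_upto t \<Longrightarrow> (\<lambda>x. c * f x) \<in> polys_upto t"
  unfolding polys_upto_def by (rule real_fun.span_scale)

lemma polys_upto_diff: "f \<in> polys_upto t \<Longrightarrow> g \<in> polys_upto t \<Longrightarrow> (\<lambda>x. f x - g x) \<in> polys_upto t"
  using polys_upto_add[of f t "\<lambda>x. -1 * g x"] polys_upto_scale[of g t "-1"] by simp

lemma polys_upto_monomial: "(\<Sum>i\<in>UNIV. m i) \<le> t \<Longrightarrow> monomial_fun m \<in> polys_upto t"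
  unfolding polys_upto_def by (rule real_fun.span_base) auto

lemma polys_upto_const: "(\<lambda>_. c) \<in> polys_upto t"
  using polys_upto_scale[OF polys_upto_monomial[of "\<lambda>_. 0" t], of c] by (simp add: monomial_fun_def)

lemma polys_upto_coord: "(\<lambda>x. x $ i) \<in> polys_upto 1"
proof -
  have "monomial_fun (\<lambda>j. if j = i then 1 else 0) = (\<lambda>x :: real ^ 'a. x $ i)"
    by (rule ext) (simp add: monomial_fun_single)
  moreover have "monomial_fun (\<lambda>j. if j = i then 1 else 0) \<in> polys_upto 1"
    by (rule polys_upto_monomial) simp
  ultimately show ?thesis by simp
qed

lemma polys_upto_mult:
  assumes "f \<in> polys_upto s" "g \<in> polys_upto t"
  shows "(\<lambda>x. f x * g x) \<in> polys_upto (s + t)"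
  using assms unfolding polys_upto_def
proof (rule span_fun_mult)
  fix a b :: "real ^ 'a \<Rightarrow> real"
  assume "a \<in> monomial_fun ` {m. sum m UNIV \<le> s}" "b \<in> monomial_fun ` {m. sum m UNIV \<le> t}"
  then obtain m m' where "a = monomial_fun m" "b = monomial_fun m'" "sum m UNIV \<le> s" "sum m' UNIV \<le> t"
    by auto
  then show "(\<lambda>x. a x * b x) \<in> real_fun.span (monomial_fun ` {m. sum m UNIV \<le> s + t})"
    by (auto simp: monomial_fun_mult sum.distrib intro!: real_fun.span_base imageI)
qed

text \<open>An induction principle with bounded degree: every polynomial is built from constants and coordinates, and it suffices
  that the property respects sums and products with the degree bound that these have.\<close>

lemma polys_upto_induct [consumes 1, case_names const coord mult add mono]:
  assumes "f \<in> polys_upto t"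
    and const: "\<And>c. P 0 (\<lambda>_. c)"
    and coord: "\<And>i. P 1 (\<lambda>x. x $ i)"
    and mult: "\<And>s t f g. P s f \<Longrightarrow> P t g \<Longrightarrow> P (s + t) (\<lambda>x. f x * g x)"
    and add: "\<And>t f g. P t f \<Longrightarrow> P t g \<Longrightarrow> P t (\<lambda>x. f x + g x)"
    and mono: "\<And>s t f. P s f \<Longrightarrow> s \<le> t \<Longrightarrow> P t f"
  shows "P t f"
proof -
  have pow: "P n (\<lambda>x. (x $ i) ^ n)" for i n
  proof (induction n)
    case (Suc n)
    then show ?case using mult[OF coord[of i] Suc] by simp
  qed (use const[of 1] in simp)
  have mon: "P (\<Sum>i\<in>I. m i) (\<lambda>x. \<Prod>i\<in>I. (x $ i) ^ m i)" if "finite I" for m I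
    using that
  proof (induction I rule: finite_induct)
    case (insert i I)
    then show ?case using mult[OF pow[of "m i" i] insert.IH] by simp
  qed (use const[of 1] in simp)
  from assms(1) show ?thesis unfolding polys_upto_def
  proof (induction rule: span_fun_induct)
    case zero
    then show ?case using mono[OF const] by simp
  next
    case (scale c a)
    then obtain m where m: "a = monomial_fun m" "sum m UNIV \<le> t" by auto
    have "P (0 + sum m UNIV) (\<lambda>x. c * a x)"
      using mult[OF const[of c] mon[of UNIV m]] m(1) by (simp add: monomial_fun_def)
    then show ?case using mono m(2) by simp
  next
    case (add f g)
    then show ?case using \<open>\<And>t f g. P t f \<Longrightarrow> P t g \<Longrightarrow> P t (\<lambda>x. f x + g x)\<close> by blast
  qed
qed

lemma polys_upto_continuous: "f \<in> polys_upto t \<Longrightarrow> continuous_on S f"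
  by (induction rule: polys_upto_induct) (auto intro!: continuous_intros)

lemma polys_upto_inner: "(\<lambda>x. a \<bullet> x) \<in> polys_upto 1"
  unfolding inner_vec_def
  by (simp, intro polys_upto_sum polys_upto_scale polys_upto_coord[unfolded One_nat_def])

lemma polys_upto_compose_linear:
  fixes f :: "real ^ 'd \<Rightarrow> real" and g :: "real ^ 'e \<Rightarrow> real ^ 'd"
  assumes "f \<in> polys_upto t" "linear g"
  shows "(\<lambda>x. f (g x)) \<in> polys_upto t"
  using assms(1)
proof (induction rule: polys_upto_induct)
  case (coord i)
  have "g x $ i = adjoint g (axis i 1) \<bullet> x" for x
    using adjoint_works[OF assms(2), of x "axis i 1"] by (simp add: inner_axis inner_commute)
  then show ?case using polys_upto_inner by simp
qed (auto intro: polys_upto_const polys_upto_mult polys_upto_add polys_upto_mono)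

lemma polys_upto_on_line:
  fixes f :: "real ^ 'd \<Rightarrow> real"
  assumes "f \<in> polys_upto t"
  obtains A where "degree A \<le> t" "\<And>s. f (a + s *\<^sub>R b) = poly A s"
proof -
  from assms have "\<exists>A. degree A \<le> t \<and> (\<forall>s. f (a + s *\<^sub>R b) = poly A s)"
  proof (induction rule: polys_upto_induct)
    case (const c)
    then show ?case by (intro exI[of _ "[:c:]"]) auto
  next
    case (coord i)
    then show ?case by (intro exI[of _ "[:a $ i, b $ i:]"]) auto
  next
    case (mult s t f g)
    then obtain A B where "degree A \<le> s" "degree B \<le> t" "\<forall>s. f (a + s *\<^sub>R b) = poly A s"
      "\<forall>s. g (a + s *\<^sub>R b) = poly B s" by blast
    then show ?case by (intro exI[of _ "A * B"]) (auto intro: order_trans[OF degree_mult_le])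
  next
    case (add t f g)
    then obtain A B where "degree A \<le> t" "degree B \<le> t" "\<forall>s. f (a + s *\<^sub>R b) = poly A s"
      "\<forall>s. g (a + s *\<^sub>R b) = poly B s" by blast
    then show ?case by (intro exI[of _ "A + B"]) (auto intro: degree_add_le)
  next
    case (mono s t f)
    then show ?case by (meson order_trans)
  qed
  then show ?thesis using that by blast
qed

text \<open>On a circle even powers of the second coordinate can be eliminated, so the restriction of a polynomial has the form
  \<open>A(s) + u B(s)\<close>. The degree bound for \<open>B\<close> that the induction carries along accounts
  for the two degrees gained by replacing \<open>u\<^sup>2\<close> with \<open>c - s\<^sup>2\<close>.\<close>

lemma polys_upto_on_circle:
  fixes f :: "real ^ 'd \<Rightarrow> real"
  assumes "f \<in> polys_upto t"
  obtains A B where "degree A \<le> t"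
    "\<And>s u. s\<^sup>2 + u\<^sup>2 = c \<Longrightarrow> f (s *\<^sub>R a + u *\<^sub>R b) = poly A s + u * poly B s"
proof -
  from assms have "\<exists>A B. degree A \<le> t \<and> (B = 0 \<or> degree B < t) \<and>
      (\<forall>s u. s\<^sup>2 + u\<^sup>2 = c \<longrightarrow> f (s *\<^sub>R a + u *\<^sub>R b) = poly A s + u * poly B s)"
  proof (induction rule: polys_upto_induct)
    case (const c)
    then show ?case by (intro exI[of _ "[:c:]"] exI[of _ 0]) auto
  next
    case (coord i)
    then show ?case by (intro exI[of _ "[:0, a $ i:]"] exI[of _ "[:b $ i:]"]) auto
  next
    case (mult m n f g)
    then obtain A B A' B' where *: "degree A \<le> m" "B = 0 \<or> degree B < m" "degree A' \<le> n" "B' = 0 \<or> degree B' < n"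
      "\<And>s u. s\<^sup>2 + u\<^sup>2 = c \<Longrightarrow> f (s *\<^sub>R a + u *\<^sub>R b) = poly A s + u * poly B s"
      "\<And>s u. s\<^sup>2 + u\<^sup>2 = c \<Longrightarrow> g (s *\<^sub>R a + u *\<^sub>R b) = poly A' s + u * poly B' s"
      by blast
    let ?A = "A * A' + [:c, 0, -1:] * (B * B')" and ?B = "A * B' + B * A'"
    have "degree (A * A') \<le> m + n" using * by (intro order_trans[OF degree_mult_le]) auto
    moreover have "degree ([:c, 0, -1:] * (B * B')) \<le> m + n"
    proof (cases "B = 0 \<or> B' = 0")
      case False
      then have "degree (B * B') + 2 \<le> m + n" using *(2,4) degree_mult_le[of B B'] by linarith
      moreover have "degree [:c, 0, -1:] = 2" by simp
      ultimately show ?thesis using degree_mult_le[of "[:c, 0, -1:]" "B * B'"] by linarith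
    qed auto
    ultimately have A: "degree ?A \<le> m + n" by (intro degree_add_le)
    have B1: "A * B' = 0 \<or> degree (A * B') < m + n"
      using *(1,4) degree_mult_le[of A B'] by fastforce
    have B2: "B * A' = 0 \<or> degree (B * A') < m + n"
      using *(2,3) degree_mult_le[of B A'] by fastforce
    have B: "?B = 0 \<or> degree ?B < m + n"
      using B1 B2 by (metis add.left_neutral add.right_neutral degree_add_less)
    have "f (s *\<^sub>R a + u *\<^sub>R b) * g (s *\<^sub>R a + u *\<^sub>R b) = poly ?A s + u * poly ?B s"
      if "s\<^sup>2 + u\<^sup>2 = c" for s u
    proof -
      have "c = s\<^sup>2 + u\<^sup>2" using that by simp
      then show ?thesis unfolding *(5,6)[OF that]
        by (simp add: algebra_simps power2_eq_square)
    qed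
    then show ?case using A B by blast
  next
    case (add t f g)
    then obtain A B A' B' where *: "degree A \<le> t" "B = 0 \<or> degree B < t" "degree A' \<le> t" "B' = 0 \<or> degree B' < t"
      "\<And>s u. s\<^sup>2 + u\<^sup>2 = c \<Longrightarrow> f (s *\<^sub>R a + u *\<^sub>R b) = poly A s + u * poly B s"
      "\<And>s u. s\<^sup>2 + u\<^sup>2 = c \<Longrightarrow> g (s *\<^sub>R a + u *\<^sub>R b) = poly A' s + u * poly B' s"
      by blast
    have "B + B' = 0 \<or> degree (B + B') < t"
      using *(2,4) by (metis add.left_neutral add.right_neutral degree_add_less)
    then show ?case using *
      by (intro exI[of _ "A + A'"] exI[of _ "B + B'"]) (auto simp: degree_add_le algebra_simps)
  next
    case (mono s t f)
    then obtain A B where "degree A \<le> s" "B = 0 \<or> degree B < s"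
      "\<forall>s u. s\<^sup>2 + u\<^sup>2 = c \<longrightarrow> f (s *\<^sub>R a + u *\<^sub>R b) = poly A s + u * poly B s"
      by blast
    then show ?case using mono(2) by (intro exI[of _ A] exI[of _ B]) auto
  qed
  then show ?thesis using that by blast
qed

text \<open>Restricted to a line through \<open>a\<close> the polynomial has infinitely many zeros.\<close>

lemma polys_upto_zero_on_open:
  fixes f :: "real ^ 'd \<Rightarrow> real"
  assumes f: "f \<in> polys_upto t" and U: "open U" "a \<in> U" "\<And>x. x \<in> U \<Longrightarrow> f x = 0"
  shows "f x = 0"
proof -
  obtain A where A: "\<And>s. f (a + s *\<^sub>R (x - a)) = poly A s" using polys_upto_on_line[OF f] by metis
  have "open ((\<lambda>s. a + s *\<^sub>R (x - a)) -` U)"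
    by (intro open_vimage U continuous_intros)
  moreover have "0 \<in> (\<lambda>s. a + s *\<^sub>R (x - a)) -` U" using U by simp
  ultimately have "infinite ((\<lambda>s. a + s *\<^sub>R (x - a)) -` U)"
    by (metis empty_iff finite_imp_not_open)
  moreover have "(\<lambda>s. a + s *\<^sub>R (x - a)) -` U \<subseteq> {s. poly A s = 0}"
    using U(3) by (auto simp flip: A)
  ultimately have "A = 0" using poly_roots_finite finite_subset by metis
  then show ?thesis using A[of 1] by simp
qed

lemma vector_avoiding_hyperplanes:
  fixes S :: "'a::euclidean_space set"
  assumes "finite S" "0 \<notin> S"
  obtains u where "\<And>a. a \<in> S \<Longrightarrow> u \<bullet> a \<noteq> 0"
proof -
  have "negligible (\<Union>a\<in>S. {x. a \<bullet> x = 0})"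
    using assms by (intro negligible_Union) (auto intro!: negligible_hyperplane)
  then obtain u where "u \<notin> (\<Union>a\<in>S. {x. a \<bullet> x = 0})"
    using open_not_negligible[of "UNIV :: 'a set"] by (metis UNIV_I UNIV_eq_I empty_iff open_UNIV)
  then show ?thesis by (intro that[of u]) (auto simp: inner_commute)
qed

text \<open>Evaluation at the powers \<open>(\<xi>\<^sub>1\<^sup>j, \<dots>, \<xi>\<^sub>d\<^sup>j)\<close> of a point with positive coordinates turns
  a linear relation between monomials into the power sums \<open>\<Sum>c\<^sub>m z\<^sub>m\<^sup>j = 0\<close>, where \<open>z\<^sub>m\<close> is the value of the monomial
  at \<open>\<xi>\<close>. For generic \<open>\<xi>\<close> the \<open>z\<^sub>m\<close> are distinct, and a polynomial that vanishes at all of them but one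
  isolates one coefficient.\<close>

lemma monomials_independent:
  fixes c :: "('d::finite \<Rightarrow> nat) \<Rightarrow> real"
  assumes M: "finite M" and zero: "\<And>x :: real ^ 'd. (\<Sum>m\<in>M. c m * monomial_fun m x) = 0" and "m0 \<in> M"
  shows "c m0 = 0"
proof -
  define vec where "vec = (\<lambda>m :: 'd \<Rightarrow> nat. (\<chi> i. real (m i)) :: real ^ 'd)"
  have vec_inj: "vec m = vec m' \<longleftrightarrow> m = m'" for m m' by (auto simp: vec_def vec_eq_iff)
  obtain u where u: "\<And>a. a \<in> (\<lambda>(m, m'). vec m - vec m') ` (M \<times> M) - {0} \<Longrightarrow> u \<bullet> a \<noteq> 0"
    using vector_avoiding_hyperplanes[of "(\<lambda>(m, m'). vec m - vec m') ` (M \<times> M) - {0}"] M by auto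
  define z where "z = (\<lambda>m. exp (u \<bullet> vec m))"
  have z_inj: "z m \<noteq> z m'" if "m \<in> M" "m' \<in> M" "m \<noteq> m'" for m m'
  proof -
    have "vec m - vec m' \<in> (\<lambda>(m, m'). vec m - vec m') ` (M \<times> M) - {0}"
      using that vec_inj by auto
    from u[OF this] show ?thesis by (simp add: z_def inner_diff_right)
  qed
  have mono: "monomial_fun m (\<chi> i. exp (u $ i) ^ j) = z m ^ j" for m j
  proof -
    have "(exp (u $ i) ^ j) ^ m i = exp (u $ i * real (m i)) ^ j" for i
      by (simp add: exp_of_nat2_mult power_mult[symmetric] mult.commute[of j])
    then show ?thesis
      by (simp add: monomial_fun_def z_def inner_vec_def vec_def exp_sum prod_power_distrib)
  qed
  have moments: "(\<Sum>m\<in>M. c m * z m ^ j) = 0" for j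
    using zero[of "\<chi> i. exp (u $ i) ^ j"] by (simp add: mono)
  define q where "q = (\<Prod>m\<in>M-{m0}. [:- z m, 1:])"
  have "(\<Sum>m\<in>M. c m * poly q (z m)) = (\<Sum>m\<in>M. \<Sum>j\<le>degree q. coeff q j * (c m * z m ^ j))"
    by (simp add: poly_altdef sum_distrib_left mult_ac)
  also have "\<dots> = (\<Sum>j\<le>degree q. coeff q j * (\<Sum>m\<in>M. c m * z m ^ j))"
    by (subst sum.swap) (simp add: sum_distrib_left)
  also have "\<dots> = 0" by (simp add: moments)
  finally have "(\<Sum>m\<in>M. c m * poly q (z m)) = 0" .
  moreover have "poly q (z m) = 0" if "m \<in> M - {m0}" for m
    using that M by (auto simp: q_def poly_prod)
  ultimately have "c m0 * poly q (z m0) = 0"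
    using M \<open>m0 \<in> M\<close> by (simp add: sum.remove)
  moreover have "poly q (z m0) \<noteq> 0" using M z_inj \<open>m0 \<in> M\<close> by (auto simp: q_def poly_prod)
  ultimately show ?thesis by simp
qed

section \<open>Counting monomials\<close>

lemma finite_degree_le: "finite {m :: 'd::finite \<Rightarrow> nat. sum m UNIV \<le> n}"
proof -
  have "{m :: 'd \<Rightarrow> nat. sum m UNIV \<le> n} \<subseteq> PiE UNIV (\<lambda>_. {..n})"
  proof
    fix m :: "'d \<Rightarrow> nat" assume "m \<in> {m. sum m UNIV \<le> n}"
    moreover have "m i \<le> sum m UNIV" for i by (rule member_le_sum) auto
    ultimately show "m \<in> PiE UNIV (\<lambda>_. {..n})" by (auto intro: order_trans)
  qed
  then show ?thesis by (rule finite_subset) (auto intro: finite_PiE)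
qed

lemma finite_degree_eq: "finite {m :: 'd::finite \<Rightarrow> nat. sum m UNIV = n}"
  by (rule finite_subset[OF _ finite_degree_le[of n]]) auto

text \<open>Both sides count the pairs of a monomial of degree \<open>n + 1\<close> and one of its factors, with multiplicity: removing the
  factor leaves a monomial of degree \<open>n\<close>.\<close>

lemma card_degree_Suc:
  "Suc n * card {m :: 'd::finite \<Rightarrow> nat. sum m UNIV = Suc n}
     = (CARD('d) + n) * card {m :: 'd \<Rightarrow> nat. sum m UNIV = n}"
proof -
  let ?M = "\<lambda>n. {m :: 'd \<Rightarrow> nat. sum m UNIV = n}"
  have step: "(\<Sum>m\<in>?M (Suc n). m i) = (\<Sum>m\<in>?M n. Suc (m i))" for i
  proof -
    have "(\<Sum>m\<in>?M (Suc n). m i) = (\<Sum>m\<in>{m\<in>?M (Suc n). m i \<noteq> 0}. m i)"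
      by (rule sum.mono_neutral_right) (auto simp: finite_degree_eq)
    also have "\<dots> = (\<Sum>m\<in>?M n. Suc (m i))"
    proof (rule sum.reindex_bij_witness[of _ "\<lambda>m. m(i := Suc (m i))" "\<lambda>m. m(i := m i - 1)"])
      have sum_upd: "sum (m(i := a)) UNIV + m i = sum m UNIV + a" for m :: "'d \<Rightarrow> nat" and a
      proof -
        have "sum (m(i := a)) (UNIV - {i}) = sum m (UNIV - {i})" by (intro sum.cong) auto
        then show ?thesis
          using sum.remove[of UNIV i m] sum.remove[of UNIV i "m(i := a)"] by simp
      qed
      show "a(i := a i - 1) \<in> ?M n" if "a \<in> {m\<in>?M (Suc n). m i \<noteq> 0}" for a
        using that sum_upd[of a "a i - 1"] by auto
      show "b(i := Suc (b i)) \<in> {m\<in>?M (Suc n). m i \<noteq> 0}" if "b \<in> ?M n" for b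
        using that sum_upd[of b "Suc (b i)"] by auto
    qed auto
    finally show ?thesis .
  qed
  have "Suc n * card (?M (Suc n)) = (\<Sum>m\<in>?M (Suc n). sum m UNIV)" by simp
  also have "\<dots> = (\<Sum>i\<in>UNIV. \<Sum>m\<in>?M (Suc n). m i)" by (rule sum.swap)
  also have "\<dots> = (\<Sum>i\<in>UNIV. \<Sum>m\<in>?M n. Suc (m i))" by (simp add: step)
  also have "\<dots> = (\<Sum>m\<in>?M n. \<Sum>i\<in>UNIV. Suc (m i))" by (rule sum.swap)
  also have "\<dots> = (\<Sum>m\<in>?M n. CARD('d) + n)"
    by (intro sum.cong) (auto simp: sum_Suc)
  also have "\<dots> = (CARD('d) + n) * card (?M n)" by simp
  finally show ?thesis .
qed

text \<open>The dimension hypothesis makes monomials of degree \<open>2k\<close> so much more numerous than those of lower degree that one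
  of at most \<open>k\<close> layers must contain twice as many points, counted up to sign, as there are monomials of degree \<open>2k - 1\<close>.\<close>

lemma card_monomials_grow:
  assumes k: "k \<ge> 2" and d: "CARD('d::finite) \<ge> 4 * k\<^sup>2 - 2 * k + 1"
  defines "D \<equiv> \<lambda>n. card {m :: 'd \<Rightarrow> nat. sum m UNIV = n}"
  shows "k * (2 * D (2 * k - 1)) \<le> D (2 * k)" and "D (2 * (k - 1)) \<le> D (2 * k - 1)"
proof -
  have dd: "4 * k\<^sup>2 \<le> CARD('d) + (2 * k - 1)" using d by linarith
  have "(2 * k) * D (2 * k) = (CARD('d) + (2 * k - 1)) * D (2 * k - 1)"
    using card_degree_Suc[of "2 * k - 1", where 'd = 'd] k by (simp add: D_def)
  also have "\<dots> \<ge> (4 * k\<^sup>2) * D (2 * k - 1)" using dd by (rule mult_right_mono) simp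
  finally have "(2 * k) * (k * (2 * D (2 * k - 1))) \<le> (2 * k) * D (2 * k)"
    by (simp add: power2_eq_square algebra_simps)
  then show "k * (2 * D (2 * k - 1)) \<le> D (2 * k)" using k by simp
  have n: "Suc (2 * (k - 1)) = 2 * k - 1" using k by simp
  have "(2 * k - 1) * D (2 * k - 1) = (CARD('d) + 2 * (k - 1)) * D (2 * (k - 1))"
    using card_degree_Suc[of "2 * (k - 1)", where 'd = 'd] unfolding D_def n .
  moreover have "(2 * k - 1) * D (2 * (k - 1)) \<le> (CARD('d) + 2 * (k - 1)) * D (2 * (k - 1))"
    using zero_less_card_finite[where 'a = 'd] k by (intro mult_right_mono) linarith+
  ultimately have "(2 * k - 1) * D (2 * (k - 1)) \<le> (2 * k - 1) * D (2 * k - 1)" by simp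
  then show "D (2 * (k - 1)) \<le> D (2 * k - 1)" using k by simp
qed

text \<open>Besides the monomials of degree \<open>2k\<close>, the constant 1 and a square of a coordinate are counted; they turn the
  weak inequality of \<open>card_monomials_grow\<close> into a strict one.\<close>

lemma card_even_monomials_gt:
  assumes "k \<ge> 2"
  shows "card {m :: 'd::finite \<Rightarrow> nat. sum m UNIV = 2 * k} + 2
    \<le> card {m :: 'd \<Rightarrow> nat. even (sum m UNIV) \<and> sum m UNIV \<le> 2 * k}"
proof -
  let ?a = "(\<lambda>_. 0) :: 'd \<Rightarrow> nat" and ?b = "(\<lambda>j. if j = undefined then 2 else 0) :: 'd \<Rightarrow> nat"
  let ?M = "{m :: 'd \<Rightarrow> nat. sum m UNIV = 2 * k}"
  have ab: "sum ?a UNIV = 0" "sum ?b UNIV = 2" by simp_all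
  then have ne: "?a \<noteq> ?b" by (metis zero_neq_numeral)
  have "card (?M \<union> {?a, ?b}) = card ?M + card {?a, ?b}"
    using ab assms by (intro card_Un_disjoint finite_degree_eq) auto
  moreover have "card {?a, ?b} = 2" using ne by simp
  moreover have "card (?M \<union> {?a, ?b}) \<le> card {m :: 'd \<Rightarrow> nat. even (sum m UNIV) \<and> sum m UNIV \<le> 2 * k}"
    using ab assms by (intro card_mono finite_subset[OF _ finite_degree_le[of "2 * k"]]) auto
  ultimately show ?thesis by simp
qed

section \<open>The dimension of the even polynomials\<close>

definition even_polys :: "nat \<Rightarrow> (real ^ 'd \<Rightarrow> real) set" where
  "even_polys n = {f \<in> polys_upto n. \<forall>x. f (- x) = f x}"

lemma even_polys_sum:
  assumes "\<And>i. i \<in> I \<Longrightarrow> f i \<in> even_polys n"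
  shows "(\<lambda>x. \<Sum>i\<in>I. c i * f i x) \<in> even_polys n"
  using assms unfolding even_polys_def
  by (auto intro!: polys_upto_sum polys_upto_scale sum.cong)

lemma sum_fun_eval: "(\<Sum>i\<in>I. f i) x = (\<Sum>i\<in>I. f i x :: real)"
  by (induction I rule: infinite_finite_induct) auto

lemma open_in_annulus:
  assumes "0 \<le> p" "ereal p < q"
  obtains U a where "open U" "a \<in> U" "U \<subseteq> (annulus p q :: (real ^ 'd) set)"
proof -
  let ?U = "{x :: real ^ 'd. p < norm x \<and> ereal (norm x) < q}"
  have "?U = norm -` (einterval (ereal p) q)" by (auto simp: einterval_def)
  then have "open ?U" by (auto intro!: open_vimage continuous_intros)
  moreover obtain r where r: "ereal p < ereal r" "ereal r < q" using ereal_dense2[OF assms(2)] by blast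
  moreover obtain x :: "real ^ 'd" where "norm x = r"
    using r assms(1) vector_choose_size[of r] by auto
  moreover have "?U \<subseteq> annulus p q" by (auto simp: annulus_def)
  ultimately show ?thesis using that[of ?U x] by auto
qed

text \<open>Lifts of a basis of the space of restrictions are independent on the whole space.\<close>

lemma dim_ge_even_polys:
  fixes p :: real and q :: ereal
  shows "dim_ge (real_fun.dim (even_polys_on (annulus p q :: (real ^ 'd) set) n)) (even_polys n :: (real ^ 'd \<Rightarrow> real) set)"
proof -
  let ?\<Omega> = "annulus p q :: (real ^ 'd) set"
  let ?V = "even_polys_on ?\<Omega> n"
  obtain B where B: "B \<subseteq> ?V" "real_fun.independent B" "card B = real_fun.dim ?V"
    by (rule real_fun.basis_exists[of ?V])
  show ?thesis
  proof (cases "finite B")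
    case False
    then show ?thesis using B(3) by (simp add: dim_ge_def)
  next
    case True
    have "\<forall>b\<in>B. \<exists>f. f \<in> even_polys n \<and> b = restrict_zero ?\<Omega> f"
      using B(1) unfolding even_polys_on_def even_polys_def by blast
    then obtain F where F': "\<forall>b\<in>B. F b \<in> even_polys n \<and> b = restrict_zero ?\<Omega> (F b)"
      unfolding bchoice_iff by blast
    have F: "F b \<in> even_polys n" "b x = restrict_zero ?\<Omega> (F b) x" if "b \<in> B" for b x
      using bspec[OF F' that] by (blast, metis)
    have "dim_ge (card B) (even_polys n :: (real ^ 'd \<Rightarrow> real) set)"
    proof (rule dim_ge_combinations[OF True])
      show "(\<lambda>x. \<Sum>b\<in>B. c b * F b x) \<in> even_polys n" for c
        using F(1) by (rule even_polys_sum)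
      show "\<exists>x. (\<Sum>b\<in>B. c b * F b x) \<noteq> 0" if c: "\<exists>b\<in>B. c b \<noteq> 0" for c
      proof (rule ccontr)
        assume "\<nexists>x. (\<Sum>b\<in>B. c b * F b x) \<noteq> 0"
        then have zero: "(\<Sum>b\<in>B. c b * F b x) = 0" for x by blast
        have "(\<Sum>b\<in>B. c b * b x) = 0" for x
        proof -
          have "(\<Sum>b\<in>B. c b * b x) = (\<Sum>b\<in>B. c b * restrict_zero ?\<Omega> (F b) x)"
            by (intro sum.cong refl) (simp add: F(2))
          also have "\<dots> = 0" using zero[of x] by (cases "x \<in> ?\<Omega>") (simp_all add: restrict_zero_def)
          finally show ?thesis .
        qed
        then have "(\<Sum>b\<in>B. (\<lambda>x. c b * b x)) = 0" by (auto simp: fun_eq_iff sum_fun_eval)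
        then have "real_fun.dependent B" using c real_fun.dependent_finite[OF True] by blast
        then show False using B(2) by blast
      qed
    qed
    then show ?thesis using B(3) by simp
  qed
qed

text \<open>Monomials stay linearly independent on \<open>\<Omega>\<close>, since \<open>\<Omega>\<close> contains a nonempty open set.\<close>

lemma card_even_monomials_le_dim:
  fixes p :: real and q :: ereal
  assumes "0 \<le> p" "ereal p < q"
  shows "card {m :: 'd::finite \<Rightarrow> nat. even (sum m UNIV) \<and> sum m UNIV \<le> n}
    \<le> real_fun.dim (even_polys_on (annulus p q :: (real ^ 'd) set) n)"
proof -
  let ?\<Omega> = "annulus p q :: (real ^ 'd) set"
  let ?V = "even_polys_on ?\<Omega> n"
  let ?T = "{m :: 'd \<Rightarrow> nat. even (sum m UNIV) \<and> sum m UNIV \<le> n}"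
  define \<rho> where "\<rho> = (\<lambda>m :: 'd \<Rightarrow> nat. restrict_zero ?\<Omega> (monomial_fun m))"
  obtain U a where U: "open U" "a \<in> U" "U \<subseteq> ?\<Omega>" using open_in_annulus[OF assms] .
  have indep: "c m0 = 0" if "finite M" "M \<subseteq> {m. sum m UNIV \<le> n}" "m0 \<in> M"
      "\<And>x. (\<Sum>m\<in>M. c m * \<rho> m x) = 0" for M c m0
  proof (rule monomials_independent[OF that(1) _ that(3)])
    have "(\<lambda>x :: real ^ 'd. \<Sum>m\<in>M. c m * monomial_fun m x) \<in> polys_upto n"
      using that(2) by (intro polys_upto_sum polys_upto_scale polys_upto_monomial) auto
    moreover have "(\<Sum>m\<in>M. c m * monomial_fun m x) = 0" if "x \<in> U" for x
      using \<open>\<And>x. (\<Sum>m\<in>M. c m * \<rho> m x) = 0\<close>[of x] that U(3) by (auto simp: \<rho>_def restrict_zero_def)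
    ultimately show "(\<Sum>m\<in>M. c m * monomial_fun m x) = 0" for x :: "real ^ 'd"
      using polys_upto_zero_on_open[OF _ U(1,2), of "\<lambda>x. \<Sum>m\<in>M. c m * monomial_fun m x" n] by blast
  qed
  have finT: "finite ?T" by (rule finite_subset[OF _ finite_degree_le[of n]]) auto
  have inj: "inj_on \<rho> ?T"
  proof (rule inj_onI, rule ccontr)
    fix m m' assume m: "m \<in> ?T" "m' \<in> ?T" "\<rho> m = \<rho> m'" "m \<noteq> m'"
    have "(1 :: real) = 0"
      using indep[of "{m, m'}" m "\<lambda>i. if i = m then 1 else -1"] m by (auto split: if_splits)
    then show False by simp
  qed
  have ind: "real_fun.independent (\<rho> ` ?T)"
  proof
    assume "real_fun.dependent (\<rho> ` ?T)"
    then obtain u b where u: "b \<in> \<rho> ` ?T" "u b \<noteq> 0" "(\<Sum>v\<in>\<rho> ` ?T. (\<lambda>x. u v * v x)) = 0"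
      using real_fun.dependent_finite[of "\<rho> ` ?T"] finT by auto
    then obtain m0 where m0: "m0 \<in> ?T" "b = \<rho> m0" by blast
    have "(\<Sum>m\<in>?T. u (\<rho> m) * \<rho> m x) = 0" for x
      using fun_cong[OF u(3), of x] by (simp add: sum_fun_eval sum.reindex[OF inj])
    then show False using indep[of ?T m0 "\<lambda>m. u (\<rho> m)"] finT m0 u(2) by auto
  qed
  have sub: "\<rho> ` ?T \<subseteq> ?V"
  proof
    fix b assume "b \<in> \<rho> ` ?T"
    then obtain m where m: "m \<in> ?T" "b = \<rho> m" by blast
    have "monomial_fun m (- x) = monomial_fun m x" for x :: "real ^ 'd"
    proof -
      have "monomial_fun m (- x) = (\<Prod>i\<in>UNIV. (-1) ^ m i * (x $ i) ^ m i)"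
        unfolding monomial_fun_def by (intro prod.cong refl) (simp add: power_minus[of "x $ _"])
      also have "\<dots> = (-1) ^ sum m UNIV * monomial_fun m x"
        by (simp add: prod.distrib power_sum monomial_fun_def)
      finally show ?thesis using m by simp
    qed
    then show "b \<in> ?V" using m polys_upto_monomial[of m n]
      by (auto simp: even_polys_on_def \<rho>_def intro!: imageI)
  qed
  obtain B where B: "B \<subseteq> ?V" "real_fun.independent B" "?V \<subseteq> real_fun.span B" "card B = real_fun.dim ?V"
    by (rule real_fun.basis_exists[of ?V])
  have "?V \<subseteq> real_fun.span (\<rho> ` {m. sum m UNIV \<le> n})"
  proof
    fix b assume "b \<in> ?V"
    then obtain f where f: "f \<in> polys_upto n" "b = restrict_zero ?\<Omega> f" by (auto simp: even_polys_on_def)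
    from f(1) have "restrict_zero ?\<Omega> f \<in> real_fun.span (\<rho> ` {m. sum m UNIV \<le> n})"
      unfolding polys_upto_def
    proof (induction rule: span_fun_induct)
      case zero
      have "restrict_zero ?\<Omega> (\<lambda>_. 0) = 0" by (auto simp: restrict_zero_def)
      then show ?case using real_fun.span_zero[of "\<rho> ` {m. sum m UNIV \<le> n}"] by metis
    next
      case (scale c a)
      then have "restrict_zero ?\<Omega> a \<in> \<rho> ` {m. sum m UNIV \<le> n}" by (auto simp: \<rho>_def)
      moreover have "restrict_zero ?\<Omega> (\<lambda>x. c * a x) = (\<lambda>x. c * restrict_zero ?\<Omega> a x)"
        by (auto simp: restrict_zero_def)
      ultimately show ?case using real_fun.span_scale[OF real_fun.span_base] by metis
    next
      case (add f g)
      have "restrict_zero ?\<Omega> (\<lambda>x. f x + g x) = (\<lambda>x. restrict_zero ?\<Omega> f x + restrict_zero ?\<Omega> g x)"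
        by (auto simp: restrict_zero_def)
      then show ?case using span_fun_add[OF add.IH] by simp
    qed
    then show "b \<in> real_fun.span (\<rho> ` {m. sum m UNIV \<le> n})" using f(2) by simp
  qed
  then have "B \<subseteq> real_fun.span (\<rho> ` {m. sum m UNIV \<le> n})" using B(1) by blast
  then have "finite B"
    using real_fun.independent_span_bound[of "\<rho> ` {m. sum m UNIV \<le> n}" B] B(2) finite_degree_le by blast
  moreover have "\<rho> ` ?T \<subseteq> real_fun.span B" using sub B(3) by blast
  ultimately have "card (\<rho> ` ?T) \<le> card B"
    using real_fun.independent_span_bound[of B "\<rho> ` ?T"] ind by blast
  then show ?thesis using card_image[OF inj] B(4) by simp
qed

section \<open>Point sets with few squared inner products\<close>

definition hom_polys :: "nat \<Rightarrow> (real ^ 'd \<Rightarrow> real) set" where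
  "hom_polys n = real_fun.span (monomial_fun ` {m. (\<Sum>i\<in>UNIV. m i) = n})"

lemma hom_polys_mult:
  assumes "f \<in> hom_polys s" "g \<in> hom_polys t"
  shows "(\<lambda>x. f x * g x) \<in> hom_polys (s + t)"
  using assms unfolding hom_polys_def
proof (rule span_fun_mult)
  fix a b :: "real ^ 'a \<Rightarrow> real"
  assume "a \<in> monomial_fun ` {m. sum m UNIV = s}" "b \<in> monomial_fun ` {m. sum m UNIV = t}"
  then obtain m m' where "a = monomial_fun m" "b = monomial_fun m'" "sum m UNIV = s" "sum m' UNIV = t"
    by auto
  then show "(\<lambda>x. a x * b x) \<in> real_fun.span (monomial_fun ` {m. sum m UNIV = s + t})"
    by (auto simp: monomial_fun_mult sum.distrib intro!: real_fun.span_base imageI)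
qed

lemma hom_polys_one: "(\<lambda>_. 1) \<in> hom_polys 0"
proof -
  have "monomial_fun (\<lambda>_. 0) \<in> hom_polys 0" unfolding hom_polys_def by (rule real_fun.span_base) auto
  then show ?thesis by (simp add: monomial_fun_def[abs_def])
qed

lemma hom_polys_inner: "(\<lambda>x. a \<bullet> x) \<in> hom_polys 1"
proof -
  have "(\<lambda>x :: real ^ 'a. x $ i) \<in> hom_polys 1" for i
  proof -
    have "monomial_fun (\<lambda>j. if j = i then 1 else 0) = (\<lambda>x :: real ^ 'a. x $ i)"
      by (rule ext) (simp add: monomial_fun_single)
    moreover have "monomial_fun (\<lambda>j. if j = i then 1 else 0) \<in> hom_polys 1"
      unfolding hom_polys_def by (intro real_fun.span_base imageI) simp
    ultimately show ?thesis by simp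
  qed
  then show ?thesis unfolding inner_vec_def hom_polys_def
    by (simp, intro span_fun_sum real_fun.span_scale)
qed

lemma hom_polys_inner_self: "(\<lambda>x. x \<bullet> x) \<in> hom_polys 2"
proof -
  have "(\<lambda>x :: real ^ 'a. (x $ i)\<^sup>2) \<in> hom_polys 2" for i
  proof -
    have "monomial_fun (\<lambda>j. if j = i then 2 else 0) = (\<lambda>x :: real ^ 'a. (x $ i)\<^sup>2)"
      by (rule ext) (simp add: monomial_fun_single)
    moreover have "monomial_fun (\<lambda>j. if j = i then 2 else 0) \<in> hom_polys 2"
      unfolding hom_polys_def by (intro real_fun.span_base imageI) simp
    ultimately show ?thesis by simp
  qed
  then show ?thesis unfolding inner_vec_def hom_polys_def
    by (simp add: power2_eq_square) (intro span_fun_sum)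
qed

lemma hom_polys_diff_scaled:
  assumes "f \<in> hom_polys n" "g \<in> hom_polys n"
  shows "(\<lambda>x. f x - c * g x) \<in> hom_polys n"
  using span_fun_add[of f _ "\<lambda>x. (- c) * g x"] real_fun.span_scale[of g _ "- c"] assms
  unfolding hom_polys_def by simp

lemma hom_polys_prod:
  assumes "finite I" "\<And>i. i \<in> I \<Longrightarrow> f i \<in> hom_polys n"
  shows "(\<lambda>x. \<Prod>i\<in>I. f i x) \<in> hom_polys (n * card I)"
  using assms
proof (induction I rule: finite_induct)
  case empty
  then show ?case using hom_polys_one by simp
next
  case (insert i I)
  then show ?case using hom_polys_mult[of "f i" n "\<lambda>x. \<Prod>i\<in>I. f i x" "n * card I"] by simp
qed

lemma hom_polys_power:
  assumes "f \<in> hom_polys n" shows "(\<lambda>x. f x ^ j) \<in> hom_polys (n * j)"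
  using hom_polys_prod[of "{..<j}" "\<lambda>_. f" n] assms by simp

lemma hom_polys_annihilated:
  assumes "h \<in> hom_polys n" "\<And>m. sum m UNIV = n \<Longrightarrow> (\<Sum>y\<in>Y. v y * monomial_fun m y) = 0"
  shows "(\<Sum>y\<in>Y. v y * h y) = 0"
  using assms(1) unfolding hom_polys_def
proof (induction rule: span_fun_induct)
  case (scale c a)
  then obtain m where "a = monomial_fun m" "sum m UNIV = n" by auto
  then have "c * (\<Sum>y\<in>Y. v y * a y) = 0" using assms(2) by simp
  then show ?case by (simp add: sum_distrib_left mult.left_commute)
qed (simp_all add: distrib_left sum.distrib)

text \<open>Vectors on \<open>Y\<close> that are orthogonal to all monomials of degree \<open>n\<close> lie in the kernel of the matrix \<open>H x y\<close>, hence are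
  eigenvectors of \<open>M\<close>, with its diagonal replaced by 0, for the eigenvalue \<open>-a/c\<close>. They form more than half of the space.\<close>

lemma low_rank_gram_ratio_rational:
  fixes Y :: "(real ^ 'd) set"
  assumes Y: "finite Y" "2 * card {m :: 'd \<Rightarrow> nat. sum m UNIV = n} < card Y"
    and H: "\<And>x. x \<in> Y \<Longrightarrow> H x \<in> hom_polys n"
    and H_eq: "\<And>x y. x \<in> Y \<Longrightarrow> y \<in> Y \<Longrightarrow> H x y = (if x = y then a else c * M x y)"
    and M: "\<And>x y. x \<in> Y \<Longrightarrow> y \<in> Y \<Longrightarrow> M x y \<in> \<rat>" and "c \<noteq> 0"
  shows "a / c \<in> \<rat>"
proof -
  let ?mon = "{m :: 'd \<Rightarrow> nat. sum m UNIV = n}"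
  let ?\<Psi> = "(\<lambda>m v. \<Sum>y\<in>Y. v y * monomial_fun m y) ` ?mon"
  let ?F = "{v. \<forall>x. x \<notin> Y \<longrightarrow> v x = 0}"
  let ?E = "{v \<in> ?F. \<forall>\<psi>\<in>?\<Psi>. \<psi> v = 0}"
  have dim: "dim_ge (card Y - card ?\<Psi>) ?E"
    using dim_ge_functions_on[OF Y(1)] finite_degree_eq by (intro dim_ge_kernel) auto
  have "card ?\<Psi> \<le> card ?mon" by (intro card_image_le finite_degree_eq)
  then have big: "card Y < 2 * (card Y - card ?\<Psi>)" using Y(2) by linarith
  have "- a / c \<in> \<rat>"
  proof -
    have 1: "(if x = y then 0 else M x y) \<in> \<rat>" if "x \<in> Y" "y \<in> Y" for x y using M that by auto
    have 2: "(\<Sum>y\<in>Y. (if x = y then 0 else M x y) * v y) = - a / c * v x" if v: "v \<in> ?E" and x: "x \<in> Y" for v x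
    proof -
      have "(\<Sum>y\<in>Y. v y * H x y) = 0"
      proof (rule hom_polys_annihilated[OF H[OF x]])
        fix m :: "'d \<Rightarrow> nat" assume "sum m UNIV = n"
        then have "(\<lambda>v. \<Sum>y\<in>Y. v y * monomial_fun m y) \<in> ?\<Psi>" by blast
        moreover have "\<forall>\<psi>\<in>?\<Psi>. \<psi> v = 0" by (rule CollectD[OF v, THEN conjunct2])
        ultimately show "(\<Sum>y\<in>Y. v y * monomial_fun m y) = 0" by (rule bspec[rotated])
      qed
      moreover have "(\<Sum>y\<in>Y. v y * H x y) = (\<Sum>y\<in>Y. (if x = y then a * v x else 0) + c * ((if x = y then 0 else M x y) * v y))"
        by (intro sum.cong) (auto simp: H_eq x)
      moreover have "\<dots> = a * v x + c * (\<Sum>y\<in>Y. (if x = y then 0 else M x y) * v y)"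
        using x Y(1) by (simp add: sum.distrib sum_distrib_left)
      ultimately show ?thesis using \<open>c \<noteq> 0\<close> by (simp add: field_simps)
    qed
    have 3: "v x = 0" if "v \<in> ?E" "\<And>y. y \<in> Y \<Longrightarrow> v y = 0" for v x
    proof (cases "x \<in> Y")
      case False
      have "v \<in> ?F" by (rule CollectD[OF that(1), THEN conjunct1])
      then show ?thesis using False by simp
    qed (rule that(2))
    show ?thesis
      by (rule rational_eigenvalue[where E = ?E and M = "\<lambda>x y. if x = y then 0 else M x y", OF Y(1) dim big])
        (fact 1 2 3)+
  qed
  then have "- (- a / c) \<in> \<rat>" by (simp only: Rats_minus_iff)
  then show ?thesis by simp
qed

text \<open>The factors of \<open>\<Prod>(t\<^sup>2 - b)\<close> are made homogeneous by \<open>\<parallel>y\<parallel>\<^sup>2\<close>, which is constant on the sphere; this keeps the rank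
  of the resulting matrices below the number of monomials of a single degree. The even product gives
  a rational number \<open>G 1 / G (\<alpha>\<^sup>2)\<close>, the product with one more factor \<open>t\<close> gives the same number divided by \<open>\<alpha>\<close>.\<close>

lemma few_squared_inner_products_rational:
  fixes Y :: "(real ^ 'd) set"
  assumes Y: "finite Y" "Y \<subseteq> sphere 0 r" and r: "r > 0" and k: "k \<ge> 1"
    and card: "2 * card {m :: 'd \<Rightarrow> nat. sum m UNIV = 2 * k - 1} < card Y"
      "2 * card {m :: 'd \<Rightarrow> nat. sum m UNIV = 2 * (k - 1)} < card Y"
    and B: "finite B" "card B \<le> k" "1 \<notin> B"
      "\<And>x y. x \<in> Y \<Longrightarrow> y \<in> Y \<Longrightarrow> x \<noteq> y \<Longrightarrow> ((x \<bullet> y) / r\<^sup>2)\<^sup>2 \<in> B"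
    and xy: "x0 \<in> Y" "y0 \<in> Y" "x0 \<noteq> y0"
  shows "(x0 \<bullet> y0) / r\<^sup>2 \<in> \<rat>"
proof (cases "x0 \<bullet> y0 = 0")
  case False
  define \<alpha> where "\<alpha> = (x0 \<bullet> y0) / r\<^sup>2"
  \<comment> \<open>The power \<open>j\<close> of \<open>\<parallel>y\<parallel>\<^sup>2\<close> fills the degree up to \<open>2k - 2\<close> when \<open>B\<close> has fewer than \<open>k\<close> elements.\<close>
  define B' where "B' = B - {\<alpha>\<^sup>2}"
  define j where "j = k - 1 - card B'"
  have \<alpha>: "\<alpha> \<noteq> 0" "\<alpha>\<^sup>2 \<in> B" using False r B(4) xy by (auto simp: \<alpha>_def)
  have cardB': "card B' \<le> k - 1" using \<alpha>(2) B(1,2) by (simp add: B'_def)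
  have finB': "finite B'" using B(1) by (simp add: B'_def)
  have norm: "x \<bullet> x = r\<^sup>2" if "x \<in> Y" for x using that Y(2) by (auto simp: power2_norm_eq_inner[symmetric])
  define H where "H = (\<lambda>x y :: real ^ 'd. (\<Prod>b\<in>B'. (x \<bullet> y)\<^sup>2 - b * r\<^sup>2 * (y \<bullet> y)) * (y \<bullet> y) ^ j)"
  define G where "G = (\<lambda>s. (\<Prod>b\<in>B'. (r\<^sup>2)\<^sup>2 * (s - b)) * (r\<^sup>2) ^ j)"
  have H_hom: "H x \<in> hom_polys (2 * (k - 1))" for x
  proof -
    have "(\<lambda>y. (x \<bullet> y)\<^sup>2) \<in> hom_polys 2"
      using hom_polys_power[OF hom_polys_inner, of x 2] by simp
    then have "(\<lambda>y. (x \<bullet> y)\<^sup>2 - b * r\<^sup>2 * (y \<bullet> y)) \<in> hom_polys 2" for b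
      using hom_polys_diff_scaled hom_polys_inner_self by blast
    then have "(\<lambda>y. \<Prod>b\<in>B'. (x \<bullet> y)\<^sup>2 - b * r\<^sup>2 * (y \<bullet> y)) \<in> hom_polys (2 * card B')"
      using finB' by (intro hom_polys_prod)
    then have "H x \<in> hom_polys (2 * card B' + 2 * j)" unfolding H_def
      by (intro hom_polys_mult hom_polys_power hom_polys_inner_self)
    moreover have "2 * card B' + 2 * j = 2 * (k - 1)" using cardB' by (simp add: j_def)
    ultimately show ?thesis by simp
  qed
  have H_val: "H x y = G (((x \<bullet> y) / r\<^sup>2)\<^sup>2)" if "y \<in> Y" for x y
  proof -
    have "(x \<bullet> y)\<^sup>2 - b * r\<^sup>2 * r\<^sup>2 = (r\<^sup>2)\<^sup>2 * (((x \<bullet> y) / r\<^sup>2)\<^sup>2 - b)" for b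
      using r by (simp add: power_divide right_diff_distrib power2_eq_square)
    then show ?thesis by (simp only: H_def G_def norm[OF that])
  qed
  have G0: "G b = 0" if "b \<in> B" "b \<noteq> \<alpha>\<^sup>2" for b
    using that finB' by (auto simp: G_def B'_def)
  have Gnz: "G b \<noteq> 0" if "b \<notin> B'" for b
    using that finB' r by (auto simp: G_def)
  have self: "((x \<bullet> x) / r\<^sup>2)\<^sup>2 = 1" if "x \<in> Y" for x using r by (simp add: norm[OF that])
  have nz: "G 1 \<noteq> 0" "G (\<alpha>\<^sup>2) \<noteq> 0" using Gnz B(3) by (auto simp: B'_def)
  have even: "G 1 / G (\<alpha>\<^sup>2) \<in> \<rat>"
  proof (rule low_rank_gram_ratio_rational[OF Y(1) card(2)])
    show "H x \<in> hom_polys (2 * (k - 1))" for x by (rule H_hom)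
    show "H x y = (if x = y then G 1 else G (\<alpha>\<^sup>2) * (if ((x \<bullet> y) / r\<^sup>2)\<^sup>2 = \<alpha>\<^sup>2 then 1 else 0))"
      if "x \<in> Y" "y \<in> Y" for x y
      using that self[of x] G0[OF B(4)[of x y]] by (auto simp: H_val)
  qed (use nz in auto)
  have odd: "(r\<^sup>2 * G 1) / (r\<^sup>2 * \<alpha> * G (\<alpha>\<^sup>2)) \<in> \<rat>"
  proof (rule low_rank_gram_ratio_rational[OF Y(1) card(1)])
    show "(\<lambda>y. (x \<bullet> y) * H x y) \<in> hom_polys (2 * k - 1)" for x
    proof -
      have "1 + 2 * (k - 1) = 2 * k - 1" using k by simp
      then show ?thesis using hom_polys_mult[OF hom_polys_inner H_hom[of x], of x] by simp
    qed
    show "(x \<bullet> y) * H x y = (if x = y then r\<^sup>2 * G 1 else (r\<^sup>2 * \<alpha> * G (\<alpha>\<^sup>2)) *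
        (if ((x \<bullet> y) / r\<^sup>2)\<^sup>2 = \<alpha>\<^sup>2 then (if (x \<bullet> y) / r\<^sup>2 = \<alpha> then 1 else -1) else 0))"
      if xy: "x \<in> Y" "y \<in> Y" for x y
    proof (cases "x = y")
      case True
      have "H y y = G 1" unfolding H_val[OF xy(2)] using r by (simp add: norm[OF xy(2)])
      then show ?thesis using True by (simp add: norm[OF xy(2)])
    next
      case False
      have eq: "x \<bullet> y = r\<^sup>2 * ((x \<bullet> y) / r\<^sup>2)" using r by simp
      show ?thesis
      proof (cases "((x \<bullet> y) / r\<^sup>2)\<^sup>2 = \<alpha>\<^sup>2")
        case True
        then have "(x \<bullet> y) / r\<^sup>2 = \<alpha> \<or> (x \<bullet> y) / r\<^sup>2 = - \<alpha>" by (simp only: power2_eq_iff)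
        moreover have "H x y = G (\<alpha>\<^sup>2)" by (simp only: H_val[OF xy(2)] True)
        ultimately show ?thesis
        proof (elim disjE)
          assume t: "(x \<bullet> y) / r\<^sup>2 = \<alpha>" and "H x y = G (\<alpha>\<^sup>2)"
          then show ?thesis using False eq by simp
        next
          assume t: "(x \<bullet> y) / r\<^sup>2 = - \<alpha>" and "H x y = G (\<alpha>\<^sup>2)"
          moreover have "\<alpha> \<noteq> - \<alpha>" using \<alpha>(1) by simp
          ultimately show ?thesis using False eq by simp
        qed
      next
        case ne: False
        then show ?thesis using False G0[OF B(4)[OF xy False]] by (simp add: H_val[OF xy(2)])
      qed
    qed
  qed (use nz \<alpha> r in auto)
  have "\<alpha> = (G 1 / G (\<alpha>\<^sup>2)) / ((r\<^sup>2 * G 1) / (r\<^sup>2 * \<alpha> * G (\<alpha>\<^sup>2)))"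
    using nz \<alpha> r by (simp add: field_simps)
  also have "\<dots> \<in> \<rat>" using even odd by (rule Rats_divide)
  finally show ?thesis by (simp add: \<alpha>_def)
qed simp

section \<open>Isometry invariance and definiteness of the integral\<close>

text \<open>The image \<open>\<mu>\<close> of Lebesgue measure is translation invariant and agrees with Lebesgue measure on the unit ball \<open>B\<close>.
  Uniqueness of such a measure is the usual argument for Haar measures: two substitutions in the double
  integral of \<open>1\<^sub>S(x) 1\<^sub>B(y)\<close> show that \<open>\<mu>(S) \<lambda>(B) = \<mu>(B) \<lambda>(S)\<close>.\<close>

lemma distr_lborel_isometry:
  fixes g :: "'a::euclidean_space \<Rightarrow> 'a"
  assumes g: "orthogonal_transformation g"
  shows "distr lborel borel g = lborel"
proof -
  define \<mu> where "\<mu> = distr lborel borel g"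
  have lin: "linear g" using g by (simp add: orthogonal_transformation_linear)
  have [measurable]: "g \<in> borel_measurable borel"
    using lin by (simp add: borel_measurable_continuous_onI linear_continuous_on linear_conv_bounded_linear)
  have surj: "surj g" using g by (rule orthogonal_transformation_surj)
  have sets_\<mu> [simp, measurable_cong]: "sets \<mu> = sets borel" and [simp]: "space \<mu> = UNIV" by (simp_all add: \<mu>_def)
  have trans: "distr \<mu> borel (\<lambda>x. a + x) = \<mu>" for a
  proof -
    obtain b where b: "a = g b" using surj by blast
    have "distr \<mu> borel (\<lambda>x. a + x) = distr lborel borel (\<lambda>x. g (b + x))"
      unfolding \<mu>_def by (subst distr_distr) (auto simp: b o_def linear_add[OF lin])
    also have "\<dots> = distr (distr lborel borel (\<lambda>x. b + x)) borel g"
      by (subst distr_distr) (auto simp: o_def)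
    also have "\<dots> = \<mu>" unfolding \<mu>_def using lborel_distr_plus[of b] by simp
    finally show ?thesis .
  qed
  let ?B = "ball (0::'a) 1"
  have ball: "g -` ?B = ?B" using orthogonal_transformation_norm[OF g] by auto
  have \<mu>B: "emeasure \<mu> ?B = emeasure lborel ?B"
    unfolding \<mu>_def by (simp add: emeasure_distr ball)
  have balls: "emeasure \<mu> {x. y - x \<in> ?B} = emeasure \<mu> ?B" for y
  proof -
    have "emeasure \<mu> ?B = emeasure (distr \<mu> borel (\<lambda>x. (-y) + x)) ?B" by (simp only: trans)
    also have "\<dots> = emeasure \<mu> ((\<lambda>x. (-y) + x) -` ?B \<inter> space \<mu>)"
      by (subst emeasure_distr) auto
    also have "(\<lambda>x. (-y) + x) -` ?B \<inter> space \<mu> = {x. y - x \<in> ?B}"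
      by (auto simp: dist_norm norm_minus_commute)
    finally show ?thesis by simp
  qed
  have fin: "emeasure lborel ?B < \<infinity>" using emeasure_bounded_finite[of ?B] by auto
  have pos: "emeasure lborel ?B \<noteq> 0"
    using open_not_negligible[of ?B] by (auto simp: negligible_iff_null_sets null_sets_completionI null_setsI)
  interpret L: sigma_finite_measure "lborel :: 'a measure" by standard
  interpret M: sigma_finite_measure \<mu>
  proof
    let ?A = "range (\<lambda>n::nat. ball (0::'a) (real n))"
    have "emeasure \<mu> (ball 0 (real n)) \<noteq> \<infinity>" for n
    proof -
      have "g -` ball 0 (real n) = ball 0 (real n)" using orthogonal_transformation_norm[OF g] by auto
      then have "emeasure \<mu> (ball 0 (real n)) = emeasure lborel (ball (0::'a) (real n))"
        unfolding \<mu>_def by (simp add: emeasure_distr)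
      then show ?thesis using emeasure_bounded_finite[of "ball (0::'a) (real n)"] by auto
    qed
    moreover have "\<Union> ?A = (UNIV :: 'a set)" by (auto simp: reals_Archimedean2)
    ultimately show "\<exists>A. countable A \<and> A \<subseteq> sets \<mu> \<and> \<Union> A = space \<mu> \<and> (\<forall>a\<in>A. emeasure \<mu> a \<noteq> \<infinity>)"
      by (intro exI[of _ ?A]) auto
  qed
  interpret pair_sigma_finite \<mu> "lborel :: 'a measure" ..
  have [measurable]: "?B \<in> sets borel" by simp
  have pair_sets: "sets (\<mu> \<Otimes>\<^sub>M lborel) = sets (borel \<Otimes>\<^sub>M (borel :: 'a measure))"
    by (intro sets_pair_measure_cong) auto
  have "emeasure \<mu> S = emeasure lborel S" if S[measurable]: "S \<in> sets borel" for S
  proof -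
    have tr: "(\<integral>\<^sup>+ x. indicator S x \<partial>\<mu>) = (\<integral>\<^sup>+ x. indicator S (y + x) \<partial>\<mu>)" for y
    proof -
      have "(\<integral>\<^sup>+ x. indicator S x \<partial>\<mu>) = (\<integral>\<^sup>+ x. indicator S x \<partial>distr \<mu> borel (\<lambda>x. y + x))"
        by (simp only: trans)
      also have "\<dots> = (\<integral>\<^sup>+ x. indicator S (y + x) \<partial>\<mu>)"
        by (subst nn_integral_distr) auto
      finally show ?thesis .
    qed
    have "emeasure \<mu> S * emeasure lborel ?B
        = (\<integral>\<^sup>+ y. indicator ?B y * (\<integral>\<^sup>+ x. indicator S x \<partial>\<mu>) \<partial>lborel)"
      by (subst nn_integral_multc) (auto simp: mult.commute intro: borel_measurable_indicator)
    also have "\<dots> = (\<integral>\<^sup>+ y. indicator ?B y * (\<integral>\<^sup>+ x. indicator S (y + x) \<partial>\<mu>) \<partial>lborel)"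
      by (rule nn_integral_cong) (rule arg_cong[OF tr])
    also have "\<dots> = (\<integral>\<^sup>+ y. (\<integral>\<^sup>+ x. indicator ?B y * indicator S (y + x) \<partial>\<mu>) \<partial>lborel)"
      by (subst nn_integral_cmult) auto
    also have "\<dots> = (\<integral>\<^sup>+ x. (\<integral>\<^sup>+ y. indicator ?B y * indicator S (y + x) \<partial>lborel) \<partial>\<mu>)"
    proof (rule Fubini')
      have "(\<lambda>x. indicator ?B (snd x) * indicator S (snd x + fst x) :: ennreal) \<in> borel_measurable (borel \<Otimes>\<^sub>M borel)"
        by measurable
      then show "(\<lambda>(x, y). indicator ?B y * indicator S (y + x) :: ennreal) \<in> borel_measurable (\<mu> \<Otimes>\<^sub>M lborel)"
        by (simp add: case_prod_unfold measurable_cong_sets[OF pair_sets refl])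
    qed
    also have "\<dots> = (\<integral>\<^sup>+ x. (\<integral>\<^sup>+ y. indicator ?B (y - x) * indicator S y \<partial>lborel) \<partial>\<mu>)"
    proof (rule nn_integral_cong)
      fix x :: 'a
      have "(\<integral>\<^sup>+ y. indicator ?B (y - x) * indicator S y \<partial>lborel)
          = (\<integral>\<^sup>+ y. indicator ?B (y - x) * indicator S y \<partial>distr lborel borel (\<lambda>y. x + y))"
        using lborel_distr_plus[of x] by simp
      also have "\<dots> = (\<integral>\<^sup>+ y. indicator ?B y * indicator S (y + x) \<partial>lborel)"
        by (subst nn_integral_distr) (auto simp: add.commute)
      finally show "(\<integral>\<^sup>+ y. indicator ?B y * indicator S (y + x) \<partial>lborel)
         = (\<integral>\<^sup>+ y. indicator ?B (y - x) * indicator S y \<partial>lborel)" by simp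
    qed
    also have "\<dots> = (\<integral>\<^sup>+ y. (\<integral>\<^sup>+ x. indicator ?B (y - x) * indicator S y \<partial>\<mu>) \<partial>lborel)"
    proof (rule Fubini'[symmetric])
      have "(\<lambda>x. indicator ?B (snd x - fst x) * indicator S (snd x) :: ennreal) \<in> borel_measurable (borel \<Otimes>\<^sub>M borel)"
        by measurable
      then show "(\<lambda>(x, y). indicator ?B (y - x) * indicator S y :: ennreal) \<in> borel_measurable (\<mu> \<Otimes>\<^sub>M lborel)"
        by (simp add: case_prod_unfold measurable_cong_sets[OF pair_sets refl])
    qed
    also have "\<dots> = (\<integral>\<^sup>+ y. emeasure \<mu> ?B * indicator S y \<partial>lborel)"
    proof (rule nn_integral_cong)
      fix y :: 'a
      have "(\<integral>\<^sup>+ x. indicator ?B (y - x) * indicator S y \<partial>\<mu>) = (\<integral>\<^sup>+ x. indicator ?B (y - x) \<partial>\<mu>) * indicator S y"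
        by (subst nn_integral_multc) auto
      also have "(\<integral>\<^sup>+ x. indicator ?B (y - x) \<partial>\<mu>) = (\<integral>\<^sup>+ x. indicator {x. y - x \<in> ?B} x \<partial>\<mu>)"
        by (intro nn_integral_cong) (auto simp: indicator_def)
      also have "\<dots> = emeasure \<mu> {x. y - x \<in> ?B}"
        by (intro nn_integral_indicator) measurable
      finally show "(\<integral>\<^sup>+ x. indicator ?B (y - x) * indicator S y \<partial>\<mu>) = emeasure \<mu> ?B * indicator S y"
        by (simp only: balls)
    qed
    also have "\<dots> = emeasure lborel ?B * emeasure lborel S"
      by (subst nn_integral_cmult) (auto simp: \<mu>B)
    finally have "emeasure lborel ?B * emeasure \<mu> S = emeasure lborel ?B * emeasure lborel S"
      by (simp only: mult.commute)
    then show ?thesis using pos fin by (auto simp: ennreal_mult_cancel_left)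
  qed
  then show ?thesis unfolding \<mu>_def[symmetric] by (intro measure_eqI) auto
qed

lemma scale_measure_eq_density: "scale_measure c M = density M (\<lambda>_. c)"
  by (rule measure_eqI) (auto simp: emeasure_density_const)

lemma measurable_normalize [measurable]:
  "(\<lambda>x :: real ^ 'd. x /\<^sub>R norm x) \<in> restrict_space lborel (cball 0 1 - {0}) \<rightarrow>\<^sub>M restrict_space borel (sphere 0 1)"
  by (intro measurable_restrict_space2 measurable_restrict_space1) (auto simp: space_restrict_space)

text \<open>Writing spherical integrals over the ball transfers the invariance of Lebesgue measure to the sphere.\<close>

lemma integral_sphere_measure:
  fixes f :: "real ^ 'd \<Rightarrow> real"
  assumes [measurable]: "f \<in> borel_measurable borel"
  shows "(LINT x|sphere_measure. f x) =
    real CARD('d) * (LINT y|lborel. indicator (cball 0 1 - {0}) y *\<^sub>R f (y /\<^sub>R norm y))"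
proof -
  let ?D = "distr (restrict_space lborel (cball 0 1 - {0})) (restrict_space borel (sphere 0 1))
        (\<lambda>x :: real ^ 'd. x /\<^sub>R norm x)"
  have meas: "f \<in> borel_measurable (restrict_space borel (sphere 0 1))"
    by (intro measurable_restrict_space1) simp
  then have measD: "f \<in> borel_measurable ?D" by simp
  have "(LINT x|sphere_measure. f x) = (LINT x|density ?D (\<lambda>_. ennreal (real CARD('d))). f x)"
    by (simp add: sphere_measure_def scale_measure_eq_density ennreal_of_nat_eq_real_of_nat)
  also have "\<dots> = (LINT x|?D. real CARD('d) *\<^sub>R f x)"
    by (rule integral_density[OF measD]) auto
  also have "\<dots> = real CARD('d) * (LINT x|?D. f x)" by simp
  also have "(LINT x|?D. f x) = (LINT x|restrict_space lborel (cball 0 1 - {0}). f (x /\<^sub>R norm x))"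
    by (rule integral_distr[OF measurable_normalize meas])
  also have "\<dots> = (LINT y|lborel. indicator (cball 0 1 - {0}) y *\<^sub>R f (y /\<^sub>R norm y))"
    by (rule integral_restrict_space) auto
  finally show ?thesis .
qed

lemma finite_sphere_measure: "finite_measure (sphere_measure :: (real ^ 'd) measure)"
proof
  have "emeasure sphere_measure (sphere 0 1 :: (real ^ 'd) set)
      = of_nat CARD('d) * emeasure lborel {r *\<^sub>R x | r x. 0 < r \<and> r \<le> 1 \<and> x \<in> sphere (0 :: real ^ 'd) 1}"
    by (rule emeasure_sphere_measure) auto
  moreover have "bounded {r *\<^sub>R x | r x. 0 < r \<and> r \<le> 1 \<and> x \<in> sphere (0 :: real ^ 'd) 1}"
    by (rule bounded_subset[of "cball 0 1"]) auto
  then have "emeasure lborel {r *\<^sub>R x | r x. 0 < r \<and> r \<le> 1 \<and> x \<in> sphere (0 :: real ^ 'd) 1} < \<infinity>"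
    by (rule emeasure_bounded_finite)
  ultimately show "emeasure (sphere_measure :: (real ^ 'd) measure) (space sphere_measure) \<noteq> \<infinity>"
    by (auto simp: ennreal_mult_eq_top_iff)
qed

lemma integrable_sphere_measure:
  fixes f :: "real ^ 'd \<Rightarrow> real"
  assumes "continuous_on UNIV f"
  shows "integrable sphere_measure f"
proof -
  have "f \<in> borel_measurable borel" using assms by (rule borel_measurable_continuous_onI)
  then have meas: "f \<in> borel_measurable sphere_measure"
    by (simp cong: measurable_cong_sets add: measurable_restrict_space1)
  have "compact (f ` sphere 0 1)"
    by (intro compact_continuous_image continuous_on_subset[OF assms]) auto
  then obtain C where "\<And>y. y \<in> f ` sphere 0 1 \<Longrightarrow> norm y \<le> C"
    using compact_imp_bounded bounded_iff by metis
  then have "AE x in sphere_measure. norm (f x) \<le> C" by (intro AE_I2) auto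
  then show ?thesis
    by (intro finite_measure.integrable_const_bound[OF finite_sphere_measure _ meas])
qed

lemma sphere_integral_isometry:
  fixes f :: "real ^ 'd \<Rightarrow> real" and g :: "real ^ 'd \<Rightarrow> real ^ 'd"
  assumes "continuous_on UNIV f" and g: "orthogonal_transformation g"
  shows "(LINT x|sphere_measure. f (g x)) = (LINT x|sphere_measure. f x)"
proof -
  have lin: "linear g" using g by (simp add: orthogonal_transformation_linear)
  have [measurable]: "cball (0 :: real ^ 'd) 1 - {0} \<in> sets borel" by auto
  have [measurable]: "(\<lambda>y :: real ^ 'd. y /\<^sub>R norm y) \<in> borel_measurable borel" by measurable
  have [measurable]: "f \<in> borel_measurable borel" using assms by (intro borel_measurable_continuous_onI)
  have [measurable]: "g \<in> borel_measurable borel"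
    using lin by (simp add: borel_measurable_continuous_onI linear_continuous_on linear_conv_bounded_linear)
  let ?h = "\<lambda>y :: real ^ 'd. indicator (cball 0 1 - {0}) y *\<^sub>R f (y /\<^sub>R norm y)"
  have h: "?h (g y) = indicator (cball 0 1 - {0}) y *\<^sub>R f (g (y /\<^sub>R norm y))" for y
    using orthogonal_transformation_norm[OF g, of y] linear_scale[OF lin]
    by (auto simp: indicator_def dest: arg_cong[where f = norm])
  have "(LINT y|lborel. ?h (g y)) = (LINT y|distr lborel borel g. ?h y)"
    by (rule integral_distr[symmetric]) (auto intro!: borel_measurable_scaleR borel_measurable_indicator)
  also have "\<dots> = (LINT y|lborel. ?h y)" by (simp only: distr_lborel_isometry[OF g])
  finally show ?thesis by (simp add: integral_sphere_measure h del: real_scaleR_def)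
qed

text \<open>If \<open>f\<close> were nonzero somewhere on the sphere, the cone over the points with \<open>f \<noteq> 0\<close>
  would contain a nonempty open set.\<close>

lemma sphere_integral_eq_0_imp:
  fixes f :: "real ^ 'd \<Rightarrow> real"
  assumes cont: "continuous_on UNIV f" and nonneg: "\<And>x. f x \<ge> 0"
    and int0: "(LINT x|sphere_measure. f x) = 0" and "norm x = 1"
  shows "f x = 0"
proof (rule ccontr)
  assume "f x \<noteq> 0"
  have [measurable]: "f \<in> borel_measurable borel" using cont by (rule borel_measurable_continuous_onI)
  let ?A = "{x \<in> sphere 0 1. f x \<noteq> 0}"
  have "AE x in sphere_measure. f x = 0"
    using integral_nonneg_eq_0_iff_AE[OF integrable_sphere_measure[OF cont]] int0 nonneg by auto
  moreover have A: "?A \<in> sets (borel :: (real ^ 'd) measure)" by measurable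
  moreover have "?A \<in> sets sphere_measure" using A by (auto simp: sets_restrict_space_iff)
  ultimately have "emeasure sphere_measure ?A = 0"
    by (subst (asm) AE_iff_measurable[where N = ?A]) auto
  then have null: "emeasure lborel {r *\<^sub>R x | r x. 0 < r \<and> r \<le> 1 \<and> x \<in> ?A} = 0" (is "emeasure lborel ?C = 0")
    by (subst (asm) emeasure_sphere_measure) (use A in auto)
  have C: "?C \<in> sets lborel"
  proof -
    have "?C = {y \<in> cball 0 1 - {0}. f (y /\<^sub>R norm y) \<noteq> 0}"
    proof (intro equalityI subsetI)
      fix y assume "y \<in> ?C"
      then show "y \<in> {y \<in> cball 0 1 - {0}. f (y /\<^sub>R norm y) \<noteq> 0}" by (auto simp: field_simps)
    next
      fix y assume y: "y \<in> {y \<in> cball 0 1 - {0}. f (y /\<^sub>R norm y) \<noteq> 0}"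
      then have "y = norm y *\<^sub>R (y /\<^sub>R norm y)" "0 < norm y" "norm y \<le> 1" "y /\<^sub>R norm y \<in> ?A" by auto
      then show "y \<in> ?C" by blast
    qed
    also have "\<dots> \<in> sets borel" by measurable
    finally show ?thesis by simp
  qed
  let ?U = "{y \<in> ball 0 1 - {0}. f (y /\<^sub>R norm y) \<noteq> 0}"
  have "continuous_on (ball 0 1 - {0}) (\<lambda>y. f (y /\<^sub>R norm y))"
    by (intro continuous_on_compose2[OF cont] continuous_intros) auto
  then have "open ((\<lambda>y. f (y /\<^sub>R norm y)) -` (- {0}) \<inter> (ball 0 1 - {0}))"
    by (subst (asm) continuous_on_open_vimage) auto
  moreover have "(\<lambda>y. f (y /\<^sub>R norm y)) -` (- {0}) \<inter> (ball 0 1 - {0}) = ?U" by auto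
  ultimately have U: "open ?U" by simp
  have "x /\<^sub>R 2 \<in> ?U" using \<open>norm x = 1\<close> \<open>f x \<noteq> 0\<close> by auto
  then have "\<not> negligible ?U" using U open_not_negligible by blast
  moreover have "?U \<subseteq> ?C"
  proof
    fix y assume y: "y \<in> ?U"
    then have "y = norm y *\<^sub>R (y /\<^sub>R norm y)" "0 < norm y" "norm y \<le> 1" "y /\<^sub>R norm y \<in> ?A" by auto
    then show "y \<in> ?C" by blast
  qed
  then have "emeasure lborel ?U \<le> emeasure lborel ?C"
    using C by (rule emeasure_mono)
  ultimately show False using null U
    by (auto simp: negligible_iff_null_sets null_sets_completionI null_setsI)
qed

text \<open>The mean over the sphere of radius \<open>r\<close> scales each monomial by a power of \<open>r\<close>. The conjunct on \<open>f\<close> in the induction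
  provides integrability of the summands.\<close>

lemma sphere_mean_polynomial:
  fixes f :: "real ^ 'd \<Rightarrow> real"
  assumes "f \<in> polys_upto t"
  obtains A where "degree A \<le> t" "\<And>r. (LINT x|sphere_measure. f (r *\<^sub>R x)) = poly A r"
proof -
  have cont: "continuous_on UNIV (\<lambda>x. g (r *\<^sub>R x))" if "g \<in> polys_upto t" for g :: "real ^ 'd \<Rightarrow> real" and r
    by (rule continuous_on_compose2[OF polys_upto_continuous[OF that, of UNIV]]) (auto intro!: continuous_intros)
  have "f \<in> real_fun.span (monomial_fun ` {m. sum m UNIV \<le> t})" using assms by (simp add: polys_upto_def)
  then have "f \<in> polys_upto t \<and> (\<exists>A. degree A \<le> t \<and> (\<forall>r. (LINT x|sphere_measure. f (r *\<^sub>R x)) = poly A r))"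
  proof (induction rule: span_fun_induct)
    case zero
    then show ?case using polys_upto_const[of 0 t] by (auto intro!: exI[of _ 0])
  next
    case (scale c a)
    then obtain m where m: "a = monomial_fun m" "sum m UNIV \<le> t" by auto
    have "monomial_fun m (r *\<^sub>R x) = r ^ (sum m UNIV) * monomial_fun m x" for r and x :: "real ^ 'd"
      by (simp add: monomial_fun_def power_mult_distrib prod.distrib power_sum)
    then have "(LINT x|sphere_measure. c * a (r *\<^sub>R x)) =
        poly (monom (c * (LINT x|sphere_measure. a x)) (sum m UNIV)) r" for r
      by (simp add: m poly_monom mult_ac)
    moreover have "degree (monom (c * (LINT x|sphere_measure. a x)) (sum m UNIV)) \<le> t"
      using degree_monom_le m(2) order_trans by blast
    moreover have "(\<lambda>x. c * a x) \<in> polys_upto t"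
      using m by (auto intro: polys_upto_scale polys_upto_monomial)
    ultimately show ?case by blast
  next
    case (add f g)
    then obtain A B where AB: "degree A \<le> t" "\<forall>r. (LINT x|sphere_measure. f (r *\<^sub>R x)) = poly A r"
      "degree B \<le> t" "\<forall>r. (LINT x|sphere_measure. g (r *\<^sub>R x)) = poly B r" by blast
    have "(LINT x|sphere_measure. f (r *\<^sub>R x) + g (r *\<^sub>R x)) = poly (A + B) r" for r
      using add AB by (simp add: Bochner_Integration.integral_add integrable_sphere_measure cont)
    then show ?case using add AB polys_upto_add degree_add_le by blast
  qed
  then show ?thesis using that by blast
qed

lemma radial_integral_isometry:
  fixes f :: "real ^ 'd \<Rightarrow> real" and g :: "real ^ 'd \<Rightarrow> real ^ 'd"
  assumes "f \<in> polys_upto t" "orthogonal_transformation g"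
  shows "radial_integral p q W (\<lambda>x. f (g x)) = radial_integral p q W f"
proof -
  have lin: "linear g" using assms(2) by (rule orthogonal_transformation_linear)
  have "(LINT x|sphere_measure. f (g (r *\<^sub>R x))) = (LINT x|sphere_measure. f (r *\<^sub>R x))" for r
  proof -
    have "continuous_on UNIV (\<lambda>x. f (r *\<^sub>R x))"
      by (rule continuous_on_compose2[OF polys_upto_continuous[OF assms(1), of UNIV]]) (auto intro!: continuous_intros)
    from sphere_integral_isometry[OF this assms(2)] show ?thesis
      by (simp add: linear_scale[OF lin])
  qed
  then show ?thesis by (simp add: radial_integral_def)
qed

lemma radial_integral_odd:
  fixes f :: "real ^ 'd \<Rightarrow> real"
  assumes "f \<in> polys_upto t" "\<And>x. f (- x) = - f x"
  shows "radial_integral p q W f = 0"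
proof -
  have "(LINT x|sphere_measure. f (r *\<^sub>R x)) = 0" for r
  proof -
    have "continuous_on UNIV (\<lambda>x. f (r *\<^sub>R x))"
      by (rule continuous_on_compose2[OF polys_upto_continuous[OF assms(1), of UNIV]]) (auto intro!: continuous_intros)
    from sphere_integral_isometry[OF this, of uminus] show ?thesis
      by (simp add: assms(2) orthogonal_transformation linear_iff)
  qed
  then show ?thesis by (simp add: radial_integral_def interval_lebesgue_integral_def set_lebesgue_integral_def)
qed

text \<open>The spherical mean of \<open>f\<^sup>2\<close> is a nonnegative polynomial \<open>A\<close> in the radius. Its weighted integral being zero, it vanishes
  almost everywhere on an interval, hence identically, and with it \<open>f\<close> on all spheres.\<close>

lemma radial_integral_square_eq_0:
  fixes f :: "real ^ 'd \<Rightarrow> real"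
  assumes f: "f \<in> polys_upto t" and p: "0 \<le> p" and pq: "ereal p < q"
    and W: "\<And>r. p \<le> r \<Longrightarrow> ereal r < q \<Longrightarrow> W r > 0"
    and moments: "\<And>j. j \<le> 2 * t \<Longrightarrow> interval_lebesgue_integrable lebesgue (ereal p) q
             (\<lambda>r. r ^ j * r ^ (CARD('d) - 1) * W r)"
    and zero: "radial_integral p q W (\<lambda>x. f x * f x) = 0"
  shows "f x = 0"
proof -
  let ?n = "CARD('d) - 1" and ?I = "einterval (ereal p) q"
  have "(\<lambda>x. f x * f x) \<in> polys_upto (2 * t)" using polys_upto_mult[OF f f] by (simp add: mult_2)
  then obtain A where A: "degree A \<le> 2 * t"
      "\<And>r. (LINT x|sphere_measure. f (r *\<^sub>R x) * f (r *\<^sub>R x)) = poly A r"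
    by (rule sphere_mean_polynomial) blast
  have le: "ereal p \<le> q" using pq by simp
  have I: "r \<in> ?I \<longleftrightarrow> p < r \<and> ereal r < q" for r by (auto simp: einterval_def)
  have A_nonneg: "poly A r \<ge> 0" for r unfolding A(2)[symmetric] by (rule integral_nonneg_AE) simp
  define F where "F = (\<lambda>r. indicator ?I r *\<^sub>R (poly A r * r ^ ?n * W r))"
  have int: "integrable lebesgue (\<lambda>r. indicator ?I r *\<^sub>R (r ^ j * r ^ ?n * W r))" if "j \<le> 2 * t" for j
    using moments[OF that] le by (simp add: interval_lebesgue_integrable_def set_integrable_def)
  have F_eq: "F = (\<lambda>r. \<Sum>j\<le>degree A. coeff A j * (indicator ?I r *\<^sub>R (r ^ j * r ^ ?n * W r)))"
    by (rule ext) (simp add: F_def poly_altdef sum_distrib_left sum_distrib_right mult_ac)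
  have F_int: "integrable lebesgue F" unfolding F_eq
    by (intro Bochner_Integration.integrable_sum integrable_mult_right int) (use A(1) in auto)
  have F_nonneg: "F r \<ge> 0" for r
    using A_nonneg[of r] W[of r] p by (auto simp: F_def I indicator_def intro!: mult_nonneg_nonneg)
  have "(LINT r|lebesgue. F r) = 0"
    using zero le by (simp add: radial_integral_def A(2) interval_lebesgue_integral_def set_lebesgue_integral_def F_def)
  then have "AE r in lebesgue. F r = 0"
    using integral_nonneg_eq_0_iff_AE[OF F_int] F_nonneg by auto
  moreover have "F r = 0 \<longleftrightarrow> poly A r = 0" if "r \<in> ?I" for r
    using that W[of r] p by (auto simp: F_def I)
  ultimately have AE: "AE r in lebesgue. r \<in> ?I \<longrightarrow> poly A r = 0" by (auto elim: eventually_mono)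
  have "A = 0"
  proof (rule ccontr)
    assume "A \<noteq> 0"
    then have fin: "finite {r. poly A r = 0}" by (rule poly_roots_finite)
    have "negligible {r. \<not> (r \<in> ?I \<longrightarrow> poly A r = 0)}"
      using AE unfolding eventually_ae_filter negligible_iff_null_sets
      by (auto intro: null_sets_completion_subset)
    then have "negligible ({r. \<not> (r \<in> ?I \<longrightarrow> poly A r = 0)} \<union> {r. poly A r = 0})"
      using fin by (rule negligible_Un[OF _ negligible_finite])
    then have "negligible ?I" by (rule negligible_subset) auto
    moreover obtain r where "r \<in> ?I" using ereal_dense2[OF pq] I by auto
    ultimately show False using open_not_negligible[of ?I] by auto
  qed
  have "f y = 0" if y: "p < norm y" for y
  proof -
    let ?r = "norm y" and ?x = "y /\<^sub>R norm y"
    have pos: "norm y \<noteq> 0" using y p by linarith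
    have "continuous_on UNIV (\<lambda>x. f (?r *\<^sub>R x))"
      by (rule continuous_on_compose2[OF polys_upto_continuous[OF f, of UNIV]]) (auto intro!: continuous_intros)
    then have "continuous_on UNIV (\<lambda>x. f (?r *\<^sub>R x) * f (?r *\<^sub>R x))" by (intro continuous_intros)
    moreover have "(LINT x|sphere_measure. f (?r *\<^sub>R x) * f (?r *\<^sub>R x)) = 0" using A(2) \<open>A = 0\<close> by simp
    ultimately have "f (?r *\<^sub>R ?x) * f (?r *\<^sub>R ?x) = 0"
      using pos by (intro sphere_integral_eq_0_imp[where f = "\<lambda>x. f (?r *\<^sub>R x) * f (?r *\<^sub>R x)"]) auto
    moreover have "?r *\<^sub>R ?x = y" using pos by simp
    ultimately show ?thesis by simp
  qed
  moreover obtain a :: "real ^ 'd" where "norm a = p + 1" using p vector_choose_size[of "p + 1"] by auto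
  moreover have "open {y :: real ^ 'd. p < norm y}" by (intro open_Collect_less continuous_intros)
  ultimately show ?thesis using polys_upto_zero_on_open[OF f, of "{y. p < norm y}" a] by simp
qed

section \<open>Reflections\<close>

definition reflection :: "'a::real_inner \<Rightarrow> 'a \<Rightarrow> 'a" where
  "reflection a y = y - (2 * (a \<bullet> y) / (a \<bullet> a)) *\<^sub>R a"

lemma linear_reflection: "linear (reflection a)"
  by (rule linearI) (simp_all add: reflection_def inner_add_right inner_scaleR_right algebra_simps
      add_divide_distrib)

lemma inner_reflection: "reflection a x \<bullet> reflection a y = x \<bullet> y"
proof (cases "a = 0")
  case False
  define c where "c = 2 / (a \<bullet> a)"
  have c: "c * (a \<bullet> a) = 2" using False by (simp add: c_def)
  have refl: "reflection a z = z - (c * (a \<bullet> z)) *\<^sub>R a" for z by (simp add: reflection_def c_def)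
  have "reflection a x \<bullet> reflection a y =
      x \<bullet> y - 2 * (c * (a \<bullet> x) * (a \<bullet> y)) + c * (a \<bullet> x) * (a \<bullet> y) * (c * (a \<bullet> a))"
    unfolding refl by (simp add: inner_diff_left inner_diff_right inner_commute[of x a] algebra_simps)
  then show ?thesis by (simp add: c)
qed (simp add: reflection_def)

lemma orthogonal_reflection: "orthogonal_transformation (reflection a)"
  by (simp add: orthogonal_transformation_def linear_reflection inner_reflection)

lemma reflection_involution [simp]: "reflection a (reflection a x) = x"
  by (cases "a = 0") (simp_all add: reflection_def inner_diff_right algebra_simps)

lemma reflection_fix: "a \<bullet> y = 0 \<Longrightarrow> reflection a y = y"
  by (simp add: reflection_def)

lemma reflection_swap:
  assumes "norm x = norm y"
  shows "reflection (x - y) x = y"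
proof (cases "x = y")
  case False
  have xy: "x \<bullet> x = y \<bullet> y" using assms by (simp add: norm_eq)
  have "(x - y) \<bullet> (x - y) = 2 * ((x - y) \<bullet> x)"
    using xy by (simp add: inner_diff_left inner_diff_right inner_commute)
  moreover have "(x - y) \<bullet> (x - y) \<noteq> 0" using False by simp
  ultimately show ?thesis by (simp add: reflection_def)
qed (simp add: reflection_fix)

text \<open>If 0 belongs to \<open>Z\<close>, then \<open>Z\<close> has an odd number of elements and the bound \<open>2 * k\<close> is not attained; this
  makes up for 0 having only one square root.\<close>

lemma card_squares_of_symmetric_set:
  fixes Z :: "real set"
  assumes "finite Z" "\<And>z. z \<in> Z \<Longrightarrow> - z \<in> Z" "card Z \<le> 2 * k"
  shows "card ((\<lambda>z. z\<^sup>2) ` Z) \<le> k"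
proof -
  let ?P = "{z \<in> Z. z > 0}" and ?N = "{z \<in> Z. z < 0}" and ?O = "{z \<in> Z. z = 0}"
  have "?N = uminus ` ?P" using assms(2) by (auto simp: image_iff) (metis neg_0_less_iff_less minus_minus)
  then have N: "card ?N = card ?P" by (simp add: card_image)
  have "card Z = card (?P \<union> ?N \<union> ?O)" by (rule arg_cong[where f = card]) auto
  also have "\<dots> = card ?P + card ?N + card ?O"
    using assms(1) by (subst card_Un_disjoint; (subst card_Un_disjoint)?; auto)
  finally have Z: "2 * card ?P + card ?O \<le> 2 * k" using N assms(3) by simp
  have "(\<lambda>z. z\<^sup>2) ` Z \<subseteq> (\<lambda>z. z\<^sup>2) ` (?P \<union> ?O)"
  proof
    fix s assume "s \<in> (\<lambda>z. z\<^sup>2) ` Z"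
    then obtain z where z: "z \<in> Z" "s = z\<^sup>2" by blast
    then have "\<bar>z\<bar> \<in> ?P \<union> ?O" "s = \<bar>z\<bar>\<^sup>2" using assms(2) by (auto simp: abs_if)
    then show "s \<in> (\<lambda>z. z\<^sup>2) ` (?P \<union> ?O)" by blast
  qed
  then have "card ((\<lambda>z. z\<^sup>2) ` Z) \<le> card ((\<lambda>z. z\<^sup>2) ` (?P \<union> ?O))" using assms(1) by (intro card_mono) auto
  also have "\<dots> \<le> card (?P \<union> ?O)" using assms(1) by (intro card_image_le) auto
  also have "\<dots> \<le> card ?P + card ?O" by (rule card_Un_le)
  also have "\<dots> \<le> k"
  proof -
    have "card ?O \<le> card {0 :: real}" by (intro card_mono) auto
    then show ?thesis using Z by simp
  qed
  finally show ?thesis .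
qed

section \<open>Formulas that attain the lower bound\<close>

text \<open>The integral appears only through the weighted sum that it equals on polynomials of degree at most \<open>4k + 1\<close>;
  the three assumptions on sums are its symmetry, invariance and definiteness. The size of \<open>X\<close> is Moeller's bound \<open>2N - 1\<close>.\<close>

locale tight_formula =
  fixes X :: "(real ^ 'd) set" and w :: "real ^ 'd \<Rightarrow> real" and k N :: nat
  assumes finite_X: "finite X" and origin: "0 \<in> X" and w_pos: "x \<in> X \<Longrightarrow> w x > 0"
    and odd_sum: "f \<in> polys_upto (4 * k + 1) \<Longrightarrow> (\<And>x. f (- x) = - f x) \<Longrightarrow> (\<Sum>x\<in>X. w x * f x) = 0"
    and isometry_sum: "f \<in> polys_upto (4 * k) \<Longrightarrow> orthogonal_transformation g \<Longrightarrow>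
      (\<Sum>x\<in>X. w x * f (g x)) = (\<Sum>x\<in>X. w x * f x)"
    and definite: "f \<in> polys_upto (2 * k) \<Longrightarrow> (\<Sum>x\<in>X. w x * (f x * f x)) = 0 \<Longrightarrow> f x = 0"
    and dim_even: "dim_ge N (even_polys (2 * k) :: (real ^ 'd \<Rightarrow> real) set)"
    and card_X: "card X + 1 = 2 * N" and N_gt_1: "1 < N"
begin

abbreviation "V \<equiv> even_polys (2 * k) :: (real ^ 'd \<Rightarrow> real) set"

lemma V_polys: "f \<in> V \<Longrightarrow> f \<in> polys_upto (2 * k)" and V_even: "f \<in> V \<Longrightarrow> f (- x) = f x"
  by (simp_all add: even_polys_def)

lemma V_scale: "f \<in> V \<Longrightarrow> (\<lambda>x. c * f x) \<in> V"
  by (simp add: even_polys_def polys_upto_scale)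

lemma V_diff: "f \<in> V \<Longrightarrow> g \<in> V \<Longrightarrow> (\<lambda>x. f x - g x) \<in> V"
  by (simp add: even_polys_def polys_upto_diff)

lemma V_compose: "f \<in> V \<Longrightarrow> linear g \<Longrightarrow> (\<lambda>x. f (g x)) \<in> V"
  by (simp add: even_polys_def polys_upto_compose_linear linear_neg)

lemma V_mult: "f \<in> V \<Longrightarrow> g \<in> V \<Longrightarrow> (\<lambda>x. f x * g x) \<in> polys_upto (4 * k)"
  using polys_upto_mult[of f "2 * k" g "2 * k"] V_polys by simp

lemma zero_on_X:
  assumes "f \<in> V" "\<And>y. y \<in> X \<Longrightarrow> f y = 0"
  shows "f x = 0"
  by (rule definite[OF V_polys[OF assms(1)]]) (simp add: assms(2))

text \<open>Unisolvent sets have at least \<open>N\<close> points, and those with exactly \<open>N\<close> points allow interpolation by \<open>V\<close>.\<close>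

definition unisolvent :: "(real ^ 'd) set \<Rightarrow> bool" where
  "unisolvent S \<longleftrightarrow> finite S \<and> (\<forall>f\<in>V. (\<forall>y\<in>S. f y = 0) \<longrightarrow> (\<forall>x. f x = 0))"

lemma unisolvent_card:
  assumes "unisolvent S"
  shows "N \<le> card S"
proof (rule ccontr)
  assume "\<not> N \<le> card S"
  then have "card S < N" by simp
  moreover have "finite S" using assms by (simp add: unisolvent_def)
  ultimately obtain f x where "f \<in> V" "f x \<noteq> 0" "\<And>y. y \<in> S \<Longrightarrow> f y = 0"
    using dim_ge_vanishing[OF dim_even] by metis
  then show False using assms by (auto simp: unisolvent_def)
qed

lemma unisolvent_interpolation:
  assumes "unisolvent S" "card S = N" "x \<in> S"
  obtains f where "f \<in> V" "f x = 1" "\<And>y. y \<in> S \<Longrightarrow> y \<noteq> x \<Longrightarrow> f y = 0"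
proof -
  have fin: "finite S" using assms(1) by (simp add: unisolvent_def)
  have "card (S - {x}) < N" using assms fin by (metis card_Diff1_less)
  then obtain f z where f: "f \<in> V" "f z \<noteq> 0" "\<And>y. y \<in> S - {x} \<Longrightarrow> f y = 0"
    using dim_ge_vanishing[OF dim_even, of "S - {x}"] fin by (metis finite_Diff)
  have "f x \<noteq> 0"
  proof
    assume "f x = 0"
    then have "\<forall>y\<in>S. f y = 0" using f(3) by blast
    then show False using assms(1) f(1,2) by (auto simp: unisolvent_def)
  qed
  then show ?thesis using f by (intro that[of "\<lambda>y. (1 / f x) * f y"] V_scale) auto
qed

text \<open>All summands of \<open>\<Sum>w(z) \<langle>a, z\<rangle> f(z)\<^sup>2 = 0\<close> are nonpositive.\<close>

lemma one_sided_vanishing: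
  assumes f: "f \<in> V" and pos: "\<And>y. y \<in> X \<Longrightarrow> a \<bullet> y > 0 \<Longrightarrow> f y = 0"
    and y: "y \<in> X" "a \<bullet> y < 0"
  shows "f y = 0"
proof -
  have "(\<lambda>z. (a \<bullet> z) * (f z * f z)) \<in> polys_upto (1 + 4 * k)"
    by (intro polys_upto_mult polys_upto_inner V_mult f)
  then have "(\<Sum>z\<in>X. w z * ((a \<bullet> z) * (f z * f z))) = 0"
    using V_even[OF f] by (intro odd_sum) (simp_all add: add.commute)
  moreover have "w z * ((a \<bullet> z) * (f z * f z)) \<le> 0" if "z \<in> X" for z
  proof (cases "a \<bullet> z > 0")
    case True
    then show ?thesis using pos that by simp
  next
    case False
    then show ?thesis using w_pos[OF that]
      by (intro mult_nonneg_nonpos mult_nonpos_nonneg) auto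
  qed
  ultimately have "w y * ((a \<bullet> y) * (f y * f y)) = 0"
    using sum_nonneg_eq_0_iff[OF finite_X, of "\<lambda>z. - (w z * ((a \<bullet> z) * (f z * f z)))"] y(1)
    by (simp add: sum_negf)
  then show ?thesis using w_pos[OF y(1)] y(2) by simp
qed

text \<open>The points of \<open>X\<close> off the line through \<open>x\<close> have nonzero projections \<open>P y\<close> to the orthogonal complement of \<open>x\<close>,
  so a generic vector of that complement is orthogonal to none of them.\<close>

lemma line_isolating_functional:
  assumes "x \<noteq> 0"
  obtains u where "u \<bullet> x = 0" "\<And>y. y \<in> X \<Longrightarrow> u \<bullet> y = 0 \<Longrightarrow> y = ((x \<bullet> y) / (x \<bullet> x)) *\<^sub>R x"
proof -
  define P where "P = (\<lambda>y. y - ((x \<bullet> y) / (x \<bullet> x)) *\<^sub>R x)"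
  obtain u where u: "\<And>a. a \<in> P ` X - {0} \<Longrightarrow> u \<bullet> a \<noteq> 0"
    using vector_avoiding_hyperplanes[of "P ` X - {0}"] finite_X by auto
  have sym: "P u \<bullet> y = u \<bullet> P y" for y
    by (simp add: P_def inner_diff_left inner_diff_right inner_commute)
  have "P x = 0" using assms by (simp add: P_def)
  then have "P u \<bullet> x = 0" by (simp add: sym)
  moreover have "y = ((x \<bullet> y) / (x \<bullet> x)) *\<^sub>R x" if "y \<in> X" "P u \<bullet> y = 0" for y
  proof -
    have "P y = 0" using u[of "P y"] that sym by auto
    then show ?thesis by (simp add: P_def)
  qed
  ultimately show ?thesis using that by blast
qed

text \<open>Let \<open>u\<close> be orthogonal to exactly those points of \<open>X\<close> that lie on the line of \<open>x\<close>. The sets \<open>C u\<close>, \<open>C (- u)\<close> are the points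
  on either side of this hyperplane, and \<open>R x\<close>, \<open>R (- x)\<close> those on the two open rays of the line.
  One side and one ray together with \<open>0\<close> form a unisolvent set, so it has at least \<open>N\<close>
  points; as the four parts and \<open>0\<close> add up to \<open>2N - 1\<close> points, it has exactly \<open>N\<close>, and there is \<open>f \<in> V\<close>
  that is 1 at \<open>x\<close> and 0 at all points of \<open>X\<close> except \<open>x\<close> and possibly points of \<open>R (- x)\<close>.

  On the line \<open>f\<close> is an even polynomial of degree at most \<open>2k\<close>, so there are at most \<open>k\<close> points on a ray. Even
  multipliers \<open>g\<close> of degree at most \<open>2k\<close> can therefore vanish at \<open>\<plusminus>y\<close> for all, or all but one, of the \<open>y\<close> on the opposite
  ray, and the sum of \<open>w f l g\<close>, where \<open>l\<close> is the coordinate on the line, isolates single points: it shows that \<open>-x\<close> must be present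
  to balance \<open>x\<close>, and that \<open>f\<close> vanishes at the other points of the opposite ray.\<close>

lemma antipodal_delta:
  assumes x: "x \<in> X" "x \<noteq> 0"
  shows "- x \<in> X" (is ?anti)
    and "\<exists>f\<in>V. f x = 1 \<and> (\<forall>y\<in>X. y \<noteq> x \<longrightarrow> y \<noteq> - x \<longrightarrow> f y = 0)" (is ?pair)
    and "\<exists>f\<in>V. f 0 = 1 \<and> (\<forall>y\<in>X. y \<noteq> 0 \<longrightarrow> f y = 0)" (is ?at_origin)
proof -
  obtain u where u: "u \<bullet> x = 0" "\<And>y. y \<in> X \<Longrightarrow> u \<bullet> y = 0 \<Longrightarrow> y = ((x \<bullet> y) / (x \<bullet> x)) *\<^sub>R x"
    using line_isolating_functional[OF x(2)] by blast
  define C where "C = (\<lambda>a. {y \<in> X. a \<bullet> y > 0})"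
  define R where "R = (\<lambda>a. {y \<in> X. u \<bullet> y = 0 \<and> a \<bullet> y > 0})"
  have xx: "x \<bullet> x > 0" using x by simp
  have fin: "finite (C a)" "finite (R a)" for a using finite_X by (auto simp: C_def R_def)
  have on_line_0: "y = 0" if "y \<in> X" "u \<bullet> y = 0" "x \<bullet> y = 0" for y
    using u(2)[OF that(1,2)] that(3) by simp
  have half_vanishing: "f z = 0"
    if a: "a = u \<or> a = - u" and b: "b = x \<or> b = - x" and f: "f \<in> V"
      and zero: "\<And>y. y \<in> C a \<union> R b \<union> {0} \<Longrightarrow> f y = 0" for a b f z
  proof (rule zero_on_X[OF f])
    fix y assume y: "y \<in> X"
    have off: "f y = 0" if "y \<in> X" "u \<bullet> y \<noteq> 0" for y
    proof (cases "a \<bullet> y > 0")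
      case True
      then show ?thesis using zero that by (simp add: C_def)
    next
      case False
      then have "a \<bullet> y < 0" using that a by auto
      then show ?thesis using zero by (intro one_sided_vanishing[OF f _ that(1), of a]) (simp_all add: C_def)
    qed
    have on: "f y = 0" if "y \<in> X" "b \<bullet> y > 0" for y
      using off[OF that(1)] zero[of y] that by (cases "u \<bullet> y = 0") (auto simp: R_def)
    show "f y = 0"
    proof (cases "b \<bullet> y = 0")
      case True
      then have "x \<bullet> y = 0" using b by auto
      then show ?thesis using off[OF y] on_line_0[OF y] zero[of 0] by (cases "u \<bullet> y = 0") auto
    next
      case False
      then show ?thesis using on one_sided_vanishing[OF f on y] y by (cases "b \<bullet> y > 0") auto
    qed
  qed
  have half_unisolvent: "unisolvent (C a \<union> R b \<union> {0})" if "a = u \<or> a = - u" "b = x \<or> b = - x" for a b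
    unfolding unisolvent_def
  proof (intro conjI ballI impI allI)
    show "finite (C a \<union> R b \<union> {0})" using fin by simp
    show "f z = 0" if "f \<in> V" "\<forall>y\<in>C a \<union> R b \<union> {0}. f y = 0" for f z
      by (rule half_vanishing[OF \<open>a = u \<or> a = - u\<close> \<open>b = x \<or> b = - x\<close> that(1)]) (use that(2) in blast)
  qed
  have card_eq: "card (C a \<union> R b \<union> {0}) = card (C a) + card (R b) + 1"
    if a: "a = u \<or> a = - u" for a b
  proof -
    have "C a \<inter> R b = {}" using a by (auto simp: C_def R_def)
    then have "card (C a \<union> R b) = card (C a) + card (R b)" using fin by (simp add: card_Un_disjoint)
    moreover have "0 \<notin> C a \<union> R b" by (auto simp: C_def R_def)
    ultimately show ?thesis using fin by simp
  qed
  have ge: "N \<le> card (C a) + card (R b) + 1" if "a = u \<or> a = - u" "b = x \<or> b = - x" for a b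
  proof -
    have "N \<le> card (C a \<union> R b \<union> {0})" by (rule unisolvent_card[OF half_unisolvent[OF that]])
    then show ?thesis using card_eq[OF that(1), of b] by simp
  qed
  have "X = (C u \<union> R x \<union> {0}) \<union> (C (- u) \<union> R (- x))"
  proof (intro equalityI subsetI)
    fix y assume y: "y \<in> X"
    consider "y = 0" | "u \<bullet> y < 0" | "u \<bullet> y > 0" | "u \<bullet> y = 0" "x \<bullet> y < 0" | "u \<bullet> y = 0" "x \<bullet> y > 0"
      using on_line_0[OF y] by (meson linorder_less_linear)
    then show "y \<in> (C u \<union> R x \<union> {0}) \<union> (C (- u) \<union> R (- x))"
      using y by cases (auto simp: C_def R_def)
  qed (use origin in \<open>auto simp: C_def R_def\<close>)
  moreover have "card (C (- u) \<union> R (- x)) = card (C (- u)) + card (R (- x))"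
    by (rule card_Un_disjoint[OF fin(1) fin(2)]) (auto simp: C_def R_def)
  moreover have "(C u \<union> R x \<union> {0}) \<inter> (C (- u) \<union> R (- x)) = {}" by (auto simp: C_def R_def)
  ultimately have "card X = card (C u) + card (R x) + 1 + (card (C (- u)) + card (R (- x)))"
    using card_Un_disjoint[of "C u \<union> R x \<union> {0}" "C (- u) \<union> R (- x)"] fin card_eq[of u x] by simp
  then have eqN: "card (C u) + card (R x) + 1 = N" "card (R x) = card (R (- x))"
    using ge[of u x] ge[of u "- x"] ge[of "- u" x] ge[of "- u" "- x"] card_X by auto
  define S where "S = C u \<union> R x \<union> {0}"
  have S: "unisolvent S" "card S = N"
    using half_unisolvent[of u x] card_eq[of u x] eqN by (auto simp: S_def)
  have xR: "x \<in> R x" using x u(1) xx by (simp add: R_def)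
  then have "x \<in> S" "0 \<in> S" by (auto simp: S_def)
  obtain f where f: "f \<in> V" "f x = 1" "\<And>y. y \<in> S \<Longrightarrow> y \<noteq> x \<Longrightarrow> f y = 0"
    using unisolvent_interpolation[OF S \<open>x \<in> S\<close>] by metis
  have f_pos: "f y = 0" if "y \<in> X" "u \<bullet> y > 0" for y
  proof -
    have "y \<noteq> x" using u(1) that(2) by auto
    then show ?thesis using f(3)[of y] that by (simp add: S_def C_def)
  qed
  then have off: "f y = 0" if "y \<in> X" "u \<bullet> y \<noteq> 0" for y
    using one_sided_vanishing[OF f(1) f_pos that(1)] that by (cases "u \<bullet> y > 0") auto
  have nonzero: "y = x \<or> y \<in> R (- x)" if "y \<in> X" "f y \<noteq> 0" for y
  proof -
    have "u \<bullet> y = 0" using off that by blast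
    have "y \<noteq> 0" using f(3)[OF \<open>0 \<in> S\<close>] x that by auto
    then have "x \<bullet> y \<noteq> 0" using on_line_0[OF that(1)] \<open>u \<bullet> y = 0\<close> by blast
    then consider "x \<bullet> y > 0" | "x \<bullet> y < 0" by linarith
    then show ?thesis
    proof cases
      case 1
      then have "y \<in> S" using \<open>u \<bullet> y = 0\<close> that(1) by (simp add: S_def R_def)
      then show ?thesis using f(3)[of y] that(2) by blast
    next
      case 2
      then show ?thesis using \<open>u \<bullet> y = 0\<close> that(1) by (simp add: R_def)
    qed
  qed
  have card_R: "card (R x) \<le> k"
  proof -
    obtain A where A: "degree A \<le> 2 * k" "\<And>s. f (0 + s *\<^sub>R x) = poly A s"
      using polys_upto_on_line[OF V_polys[OF f(1)]] by metis
    have A1: "poly A 1 \<noteq> 0" using A(2)[of 1] f(2) by simp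
    then have "A \<noteq> 0" by auto
    let ?T = "(\<lambda>y. (x \<bullet> y) / (x \<bullet> x)) ` (R x - {x})"
    have T: "poly A s = 0" "poly A (- s) = 0" "s > 0" if sT: "s \<in> ?T" for s
    proof -
      obtain y where y: "y \<in> R x" "y \<noteq> x" "s = (x \<bullet> y) / (x \<bullet> x)" using sT by blast
      have "y = s *\<^sub>R x" using u(2)[of y] y by (simp add: R_def)
      moreover have "f y = 0" using f(3)[of y] y by (simp add: S_def)
      ultimately show "poly A s = 0" "poly A (- s) = 0"
        using A(2)[of s] A(2)[of "- s"] V_even[OF f(1), of y] by simp_all
      show "s > 0" using y xx by (simp add: R_def)
    qed
    have "inj_on (\<lambda>y. (x \<bullet> y) / (x \<bullet> x)) (R x - {x})"
    proof (rule inj_onI)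
      fix y z assume "y \<in> R x - {x}" "z \<in> R x - {x}" and eq: "(x \<bullet> y) / (x \<bullet> x) = (x \<bullet> z) / (x \<bullet> x)"
      then have "y = ((x \<bullet> y) / (x \<bullet> x)) *\<^sub>R x" "z = ((x \<bullet> z) / (x \<bullet> x)) *\<^sub>R x"
        using u(2) by (simp_all add: R_def)
      then show "y = z" using eq by simp
    qed
    then have cT: "card ?T = card (R x) - 1" using xR fin by (simp add: card_image)
    have "poly A 0 = 0" using A(2)[of 0] f(3)[OF \<open>0 \<in> S\<close>] x by simp
    \<comment> \<open>Besides \<open>\<plusminus>y\<close> for the other points \<open>y\<close> on the ray of \<open>x\<close>, also \<open>0\<close> is a zero: this extra zero gives \<open>k\<close> rather than \<open>k + 1\<close>.\<close>
    then have "insert 0 (?T \<union> uminus ` ?T) \<subseteq> {s. poly A s = 0}" using T by auto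
    then have "card (insert 0 (?T \<union> uminus ` ?T)) \<le> 2 * k"
      using card_mono[OF poly_roots_finite[OF \<open>A \<noteq> 0\<close>]] card_poly_roots_bound[OF \<open>A \<noteq> 0\<close>] A(1)
      by (meson order_trans)
    moreover have "card (?T \<union> uminus ` ?T) = 2 * (card (R x) - 1)"
    proof -
      have "s \<notin> uminus ` ?T" if "s \<in> ?T" for s
      proof
        assume "s \<in> uminus ` ?T"
        then obtain s' where "s' \<in> ?T" "s = - s'" by blast
        then show False using T(3)[OF that] T(3)[of s'] by simp
      qed
      then have "?T \<inter> uminus ` ?T = {}" by blast
      then have "card (?T \<union> uminus ` ?T) = card ?T + card (uminus ` ?T)"
        using fin by (intro card_Un_disjoint) auto
      also have "card (uminus ` ?T) = card ?T" by (rule card_image) simp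
      finally show ?thesis using cT by simp
    qed
    moreover have "0 \<notin> ?T \<union> uminus ` ?T" using T(3) by force
    ultimately have "2 * (card (R x) - 1) + 1 \<le> 2 * k" using fin by simp
    then show ?thesis by linarith
  qed
  \<comment> \<open>On the line of \<open>x\<close> this multiplier vanishes exactly at the points \<open>\<plusminus>y\<close> with \<open>y \<in> D\<close>.\<close>
  define g where "g = (\<lambda>D z. \<Prod>y\<in>D. (x \<bullet> z)\<^sup>2 - (x \<bullet> y)\<^sup>2)"
  have g_sum: "(\<Sum>z\<in>X. w z * (f z * (x \<bullet> z) * g D z)) = 0" if D: "D \<subseteq> R (- x)" for D
  proof -
    have finD: "finite D" using D fin finite_subset by blast
    have "card D \<le> k" using D fin card_R eqN(2) card_mono[of "R (- x)" D] by simp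
    have "g D \<in> polys_upto (2 * card D)" using finD unfolding g_def
    proof (induction D rule: finite_induct)
      case empty
      then show ?case by (simp add: polys_upto_const)
    next
      case (insert y D)
      have "(\<lambda>z. (x \<bullet> z)\<^sup>2) \<in> polys_upto 2"
        using polys_upto_mult[OF polys_upto_inner polys_upto_inner, of x x]
        by (simp add: power2_eq_square numeral_2_eq_2)
      then have "(\<lambda>z. (x \<bullet> z)\<^sup>2 - (x \<bullet> y)\<^sup>2) \<in> polys_upto 2"
        by (intro polys_upto_diff polys_upto_const)
      from polys_upto_mult[OF this insert.IH] insert.hyps show ?case by simp
    qed
    then have "(\<lambda>z. f z * (x \<bullet> z) * g D z) \<in> polys_upto (2 * k + 1 + 2 * card D)"
      by (intro polys_upto_mult polys_upto_inner V_polys f)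
    then have "(\<lambda>z. f z * (x \<bullet> z) * g D z) \<in> polys_upto (4 * k + 1)"
      using \<open>card D \<le> k\<close> by (elim polys_upto_mono) simp
    then show ?thesis by (rule odd_sum) (simp add: V_even[OF f(1)] g_def)
  qed
  have line_neg: "y = ((x \<bullet> y) / (x \<bullet> x)) *\<^sub>R x" "x \<bullet> y < 0" "y \<in> X" if "y \<in> R (- x)" for y
    using that u(2)[of y] by (auto simp: R_def)
  show ?anti
  proof (rule ccontr)
    assume "- x \<notin> X"
    have "(\<Sum>z\<in>X. w z * (f z * (x \<bullet> z) * g (R (- x)) z)) = w x * (f x * (x \<bullet> x) * g (R (- x)) x)"
    proof -
      have "w z * (f z * (x \<bullet> z) * g (R (- x)) z) = 0" if "z \<in> X - {x}" for z
      proof (cases "z \<in> R (- x)")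
        case True
        then have "g (R (- x)) z = 0" using fin by (auto simp: g_def)
        then show ?thesis by simp
      next
        case False
        then have "f z = 0" using nonzero[of z] that by blast
        then show ?thesis by simp
      qed
      then have "(\<Sum>z\<in>X - {x}. w z * (f z * (x \<bullet> z) * g (R (- x)) z)) = 0" by (intro sum.neutral) blast
      then show ?thesis by (simp only: sum.remove[OF finite_X x(1)] add_0_right)
    qed
    moreover have "g (R (- x)) x \<noteq> 0"
    proof
      assume "g (R (- x)) x = 0"
      then obtain y where y: "y \<in> R (- x)" "(x \<bullet> x)\<^sup>2 = (x \<bullet> y)\<^sup>2" using fin by (auto simp: g_def)
      then have "x \<bullet> y = - (x \<bullet> x)" using line_neg(2)[OF y(1)] xx by (auto simp: power2_eq_iff)
      then have "y = - x" using line_neg(1)[OF y(1)] xx by simp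
      then show False using line_neg(3)[OF y(1)] \<open>- x \<notin> X\<close> by simp
    qed
    ultimately show False using g_sum[of "R (- x)"] w_pos[OF x(1)] f(2) xx by auto
  qed
  have "f y = 0" if y: "y \<in> X" "y \<noteq> x" "y \<noteq> - x" for y
  proof (rule ccontr)
    assume "f y \<noteq> 0"
    then have yR: "y \<in> R (- x)" using nonzero y by blast
    \<comment> \<open>Now \<open>-x \<in> D\<close>, so the multiplier also removes the term at \<open>x\<close> and only the one at \<open>y\<close> remains.\<close>
    let ?D = "R (- x) - {y}"
    have mx: "- x \<in> ?D" using \<open>- x \<in> X\<close> u(1) xx y by (simp add: R_def)
    have "(\<Sum>z\<in>X. w z * (f z * (x \<bullet> z) * g ?D z)) = w y * (f y * (x \<bullet> y) * g ?D y)"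
    proof -
      have "w z * (f z * (x \<bullet> z) * g ?D z) = 0" if "z \<in> X - {y}" for z
      proof (cases "z \<in> R (- x) \<or> z = x")
        case True
        then have "\<exists>v\<in>?D. (x \<bullet> z)\<^sup>2 = (x \<bullet> v)\<^sup>2"
        proof
          assume "z = x"
          then show ?thesis using mx by (intro bexI[of _ "- x"]) auto
        qed (use that in blast)
        then have "g ?D z = 0" using fin by (auto simp: g_def)
        then show ?thesis by simp
      next
        case False
        then have "f z = 0" using nonzero[of z] that by blast
        then show ?thesis by simp
      qed
      then have "(\<Sum>z\<in>X - {y}. w z * (f z * (x \<bullet> z) * g ?D z)) = 0" by (intro sum.neutral) blast
      then show ?thesis by (simp only: sum.remove[OF finite_X y(1)] add_0_right)
    qed
    moreover have "g ?D y \<noteq> 0"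
    proof
      assume "g ?D y = 0"
      then obtain v where v: "v \<in> R (- x)" "v \<noteq> y" "(x \<bullet> y)\<^sup>2 = (x \<bullet> v)\<^sup>2" using fin by (auto simp: g_def)
      then have "x \<bullet> y = x \<bullet> v" using line_neg(2)[OF v(1)] line_neg(2)[OF yR] by (auto simp: power2_eq_iff)
      then show False using line_neg(1)[OF v(1)] line_neg(1)[OF yR] v(2) by simp
    qed
    ultimately show False using g_sum[of ?D] w_pos[OF y(1)] \<open>f y \<noteq> 0\<close> line_neg(2)[OF yR] by auto
  qed
  then show ?pair using f by blast
  obtain h where h: "h \<in> V" "h 0 = 1" "\<And>y. y \<in> S \<Longrightarrow> y \<noteq> 0 \<Longrightarrow> h y = 0"
    using unisolvent_interpolation[OF S \<open>0 \<in> S\<close>] by metis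
  have pos: "h z = 0" if "z \<in> X" "u \<bullet> z > 0" for z
    using h(3)[of z] that by (cases "z = 0") (auto simp: S_def C_def)
  then have hoff: "h z = 0" if "z \<in> X" "u \<bullet> z \<noteq> 0" for z
    using one_sided_vanishing[OF h(1) pos that(1)] that by (cases "u \<bullet> z > 0") auto
  have hpos: "h z = 0" if "z \<in> X" "x \<bullet> z > 0" for z
    using hoff[OF that(1)] h(3)[of z] that by (cases "z = 0"; cases "u \<bullet> z = 0") (auto simp: S_def R_def)
  have "h y = 0" if "y \<in> X" "y \<noteq> 0" for y
  proof (cases "x \<bullet> y = 0")
    case True
    then show ?thesis using hoff[OF that(1)] on_line_0[OF that(1)] that by blast
  next
    case False
    then show ?thesis using hpos one_sided_vanishing[OF h(1) hpos that(1)] that by (cases "x \<bullet> y > 0") auto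
  qed
  then show ?at_origin using h by blast
qed

section \<open>The reproducing kernel\<close>

text \<open>The indicator of \<open>{x, -x}\<close> that \<open>V\<close> contains, divided by the weight of this set, reproduces values at \<open>x\<close>: the sum over \<open>X\<close> has no other terms.\<close>

lemma kernel_exists:
  assumes x: "x \<in> X"
  shows "\<exists>h. h \<in> V \<and> (\<forall>f\<in>V. (\<Sum>z\<in>X. w z * (h z * f z)) = f x) \<and> h x > 0
    \<and> (\<forall>y\<in>X. y \<noteq> x \<longrightarrow> y \<noteq> - x \<longrightarrow> h y = 0)"
proof (cases "x = 0")
  case True
  have "\<not> X \<subseteq> {0}"
  proof
    assume "X \<subseteq> {0}"
    then have "card X \<le> card {0 :: real ^ 'd}" by (intro card_mono) auto
    then show False using card_X N_gt_1 by simp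
  qed
  then obtain y where "y \<in> X" "y \<noteq> 0" by blast
  from antipodal_delta(3)[OF this] obtain h where h: "h \<in> V" "h 0 = 1" "\<And>y. y \<in> X \<Longrightarrow> y \<noteq> 0 \<Longrightarrow> h y = 0"
    by blast
  define c where "c = 1 / w 0"
  have c: "c > 0" "w 0 * c = 1" using w_pos[OF origin] by (simp_all add: c_def)
  have "(\<Sum>z\<in>X. w z * (c * h z * f z)) = f 0" for f :: "real ^ 'd \<Rightarrow> real"
  proof -
    have "(\<Sum>z\<in>X - {0}. w z * (c * h z * f z)) = 0" using h(3) by (intro sum.neutral) auto
    then show ?thesis
      using c(2) by (simp add: sum.remove[OF finite_X origin] h(2) mult.assoc[symmetric])
  qed
  then show ?thesis using True h c(1)
    by (intro exI[of _ "\<lambda>y. c * h y"]) (auto intro: V_scale)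
next
  case False
  note anti = antipodal_delta(1)[OF x False]
  obtain h where h: "h \<in> V" "h x = 1" "\<And>y. y \<in> X \<Longrightarrow> y \<noteq> x \<Longrightarrow> y \<noteq> - x \<Longrightarrow> h y = 0"
    using antipodal_delta(2)[OF x False] by blast
  have ne: "x \<noteq> - x"
  proof
    assume "x = - x"
    then have "x \<bullet> x = x \<bullet> (- x)" by (rule arg_cong)
    then show False using False by simp
  qed
  define c where "c = 1 / (w x + w (- x))"
  have c: "c > 0" "c * (w x + w (- x)) = 1"
    using w_pos[OF x] w_pos[OF anti] by (simp_all add: c_def)
  have "(\<Sum>z\<in>X. w z * (c * h z * f z)) = f x" if "f \<in> V" for f
  proof -
    have "(\<Sum>z\<in>X. w z * (c * h z * f z)) = (\<Sum>z\<in>{x, - x}. w z * (c * h z * f z))"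
      using finite_X x anti h(3) by (intro sum.mono_neutral_right) auto
    also have "\<dots> = w x * (c * f x) + w (- x) * (c * f x)"
      using ne h(2) V_even[OF h(1), of x] V_even[OF that, of x] by simp
    also have "\<dots> = c * (w x + w (- x)) * f x" by (simp add: algebra_simps)
    finally show ?thesis using c(2) by simp
  qed
  then show ?thesis using h c(1)
    by (intro exI[of _ "\<lambda>y. c * h y"]) (auto intro: V_scale)
qed

definition kernel :: "real ^ 'd \<Rightarrow> real ^ 'd \<Rightarrow> real" where
  "kernel x = (SOME h. h \<in> V \<and> (\<forall>f\<in>V. (\<Sum>z\<in>X. w z * (h z * f z)) = f x) \<and> h x > 0
    \<and> (\<forall>y\<in>X. y \<noteq> x \<longrightarrow> y \<noteq> - x \<longrightarrow> h y = 0))"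

lemma
  assumes "x \<in> X"
  shows kernel_in_V: "kernel x \<in> V"
    and kernel_reproduces: "f \<in> V \<Longrightarrow> (\<Sum>z\<in>X. w z * (kernel x z * f z)) = f x"
    and kernel_self: "kernel x x > 0"
    and kernel_zero: "y \<in> X \<Longrightarrow> y \<noteq> x \<Longrightarrow> y \<noteq> - x \<Longrightarrow> kernel x y = 0"
  using someI_ex[OF kernel_exists[OF assms]] unfolding kernel_def[symmetric] by auto

lemma reproducing_unique:
  assumes "h \<in> V" "h' \<in> V"
    and "\<And>f. f \<in> V \<Longrightarrow> (\<Sum>z\<in>X. w z * (h z * f z)) = (\<Sum>z\<in>X. w z * (h' z * f z))"
  shows "h y = h' y"
proof -
  let ?d = "\<lambda>z. h z - h' z"
  have d: "?d \<in> V" using assms(1,2) by (rule V_diff)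
  have "(\<Sum>z\<in>X. w z * (?d z * ?d z)) = (\<Sum>z\<in>X. w z * (h z * ?d z) - w z * (h' z * ?d z))"
    by (intro sum.cong refl) (simp add: algebra_simps)
  also have "\<dots> = (\<Sum>z\<in>X. w z * (h z * ?d z)) - (\<Sum>z\<in>X. w z * (h' z * ?d z))"
    by (rule sum_subtractf)
  also have "\<dots> = 0" using assms(3)[OF d] by simp
  finally have "?d y = 0" by (rule definite[OF V_polys[OF d]])
  then show ?thesis by simp
qed

text \<open>Both sides, as functions of \<open>y\<close>, reproduce values at \<open>x\<close>. This covers points \<open>y\<close> off \<open>X\<close>, such as those of the circle in \<open>kernel_on_layer\<close>.\<close>

lemma kernel_isometry:
  assumes x: "x \<in> X" "g x \<in> X" and g: "orthogonal_transformation g" "\<And>y. g (g y) = y"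
  shows "kernel (g x) (g y) = kernel x y"
proof (rule reproducing_unique)
  have lin: "linear g" using g(1) by (rule orthogonal_transformation_linear)
  show "(\<lambda>y. kernel (g x) (g y)) \<in> V" using kernel_in_V[OF x(2)] lin by (rule V_compose)
  show "kernel x \<in> V" using x(1) by (rule kernel_in_V)
  fix f assume f: "f \<in> V"
  have fg: "(\<lambda>z. f (g z)) \<in> V" using f lin by (rule V_compose)
  have "(\<Sum>z\<in>X. w z * (kernel (g x) (g z) * f z)) = (\<Sum>z\<in>X. w z * (kernel (g x) (g z) * f (g (g z))))"
    by (simp add: g(2))
  also have "\<dots> = (\<Sum>z\<in>X. w z * (kernel (g x) z * f (g z)))"
    using isometry_sum[OF V_mult[OF kernel_in_V[OF x(2)] fg] g(1)] by simp
  also have "\<dots> = f x" using kernel_reproduces[OF x(2) fg] by (simp add: g(2))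
  also have "\<dots> = (\<Sum>z\<in>X. w z * (kernel x z * f z))" using kernel_reproduces[OF x(1) f] by simp
  finally show "(\<Sum>z\<in>X. w z * (kernel (g x) (g z) * f z)) = (\<Sum>z\<in>X. w z * (kernel x z * f z))" .
qed

lemma kernel_reflection:
  assumes "x \<in> X" "reflection a x \<in> X"
  shows "kernel (reflection a x) (reflection a y) = kernel x y"
  using assms by (intro kernel_isometry orthogonal_reflection reflection_involution)

text \<open>Reflections move \<open>y\<close> to any other point of the same norm, so \<open>K(0, y)\<close> is given by its values on a line, an even polynomial of degree at most \<open>2k\<close>. It is positive
  at 0 and vanishes at \<open>\<plusminus>r\<close> for every radius \<open>r\<close>.\<close>

lemma card_radii: "card (norm ` (X - {0})) \<le> k"
proof -
  let ?e = "axis undefined 1 :: real ^ 'd"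
  have e: "norm ?e = 1" by simp
  obtain A where A: "degree A \<le> 2 * k" "\<And>s. kernel 0 (0 + s *\<^sub>R ?e) = poly A s"
    using polys_upto_on_line[OF V_polys[OF kernel_in_V[OF origin]]] by metis
  have "poly A 0 > 0" using A(2)[of 0] kernel_self[OF origin] by simp
  then have "A \<noteq> 0" by auto
  have radial: "kernel 0 y = kernel 0 (norm y *\<^sub>R ?e)" for y
  proof -
    have "reflection (y - norm y *\<^sub>R ?e) y = norm y *\<^sub>R ?e" by (rule reflection_swap) simp
    moreover have "reflection (y - norm y *\<^sub>R ?e) 0 = 0" by (simp add: reflection_fix)
    ultimately show ?thesis using kernel_reflection[of 0 "y - norm y *\<^sub>R ?e" y] origin by simp
  qed
  let ?R = "norm ` (X - {0})" and ?Z = "norm ` (X - {0}) \<union> uminus ` norm ` (X - {0})"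
  have zero: "poly A s = 0 \<and> poly A (- s) = 0" if s: "s \<in> ?R" for s
  proof -
    obtain y where y: "y \<in> X" "y \<noteq> 0" "s = norm y" using s by blast
    have "poly A s = 0" using A(2)[of s] radial[of y] kernel_zero[OF origin y(1)] y by simp
    moreover have "kernel 0 (- (s *\<^sub>R ?e)) = kernel 0 (s *\<^sub>R ?e)" by (rule V_even[OF kernel_in_V[OF origin]])
    ultimately show ?thesis using A(2)[of s] A(2)[of "- s"] by simp
  qed
  then have "?Z \<subseteq> {s. poly A s = 0}" by auto
  then have "card ?Z \<le> 2 * k"
    using card_mono[OF poly_roots_finite[OF \<open>A \<noteq> 0\<close>]] card_poly_roots_bound[OF \<open>A \<noteq> 0\<close>] A(1)
    by (meson order_trans)
  then have "card ((\<lambda>z. z\<^sup>2) ` ?Z) \<le> k"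
    using finite_X by (intro card_squares_of_symmetric_set) auto
  moreover have "card ((\<lambda>z. z\<^sup>2) ` ?R) \<le> card ((\<lambda>z. z\<^sup>2) ` ?Z)"
    using finite_X by (intro card_mono) auto
  moreover have "card ((\<lambda>z. z\<^sup>2) ` ?R) = card ?R"
    by (rule card_image) (auto simp: inj_on_def)
  ultimately show ?thesis by simp
qed

text \<open>Two reflections move a pair of points of norm \<open>r\<close> to \<open>x0\<close> and a point of the circle spanned by \<open>x0\<close> and
  a vector \<open>e\<close> orthogonal to it, keeping the inner product. A further reflection changes the sign of the second coordinate, so
  on this circle \<open>K(x0, \<cdot>)\<close> is a polynomial in the first coordinate alone.\<close>

lemma kernel_on_layer:
  assumes r: "r > 0" and x0: "x0 \<in> X" "norm x0 = r" and d: "CARD('d) \<ge> 2"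
  obtains A where "degree A \<le> 2 * k" "poly A 1 > 0"
    "\<And>s. \<bar>s\<bar> \<le> 1 \<Longrightarrow> poly A (- s) = poly A s"
    "\<And>x y. x \<in> X \<Longrightarrow> norm x = r \<Longrightarrow> norm y = r \<Longrightarrow> kernel x y = poly A ((x \<bullet> y) / r\<^sup>2)"
proof -
  obtain e0 where "e0 \<noteq> 0" and orth: "x0 \<bullet> e0 = 0"
    using orthogonal_to_vector_exists[of x0] d by (auto simp: orthogonal_def)
  define e where "e = (r / norm e0) *\<^sub>R e0"
  have e: "norm e = r" "x0 \<bullet> e = 0" using \<open>e0 \<noteq> 0\<close> orth r by (simp_all add: e_def)
  have x0x0: "x0 \<bullet> x0 = r\<^sup>2" and ee: "e \<bullet> e = r\<^sup>2" using x0 e by (simp_all add: power2_norm_eq_inner[symmetric])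
  have norm_sq: "(norm (s *\<^sub>R x0 + u *\<^sub>R e))\<^sup>2 = (s\<^sup>2 + u\<^sup>2) * r\<^sup>2" for s u
  proof -
    have "e \<bullet> x0 = 0" using e(2) by (simp only: inner_commute)
    then have "(norm (s *\<^sub>R x0 + u *\<^sub>R e))\<^sup>2 = s * (s * r\<^sup>2) + u * (u * r\<^sup>2)"
      by (simp add: power2_norm_eq_inner inner_add_left inner_add_right e(2) x0x0 ee)
    then show ?thesis by (simp only: power2_eq_square distrib_right mult.assoc)
  qed
  let ?h = "kernel x0"
  have hV: "?h \<in> V" using x0(1) by (rule kernel_in_V)
  obtain A B where A: "degree A \<le> 2 * k"
      "\<And>s u. s\<^sup>2 + u\<^sup>2 = 1 \<Longrightarrow> ?h (s *\<^sub>R x0 + u *\<^sub>R e) = poly A s + u * poly B s"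
    using polys_upto_on_circle[OF V_polys[OF hV]] by metis
  have fixed: "?h y = ?h z" if "norm y = norm z" "x0 \<bullet> y = x0 \<bullet> z" for y z
  proof -
    have "reflection (y - z) x0 = x0" using that(2)
      by (intro reflection_fix) (simp add: inner_diff_right inner_commute[of _ x0])
    moreover have "reflection (y - z) y = z" using that(1) by (rule reflection_swap)
    ultimately show ?thesis using kernel_reflection[of x0 "y - z" y] x0(1) by simp
  qed
  have flip: "?h (s *\<^sub>R x0 + u *\<^sub>R e) = ?h (s *\<^sub>R x0 + (- u) *\<^sub>R e)" for s u
  proof (rule fixed)
    show "norm (s *\<^sub>R x0 + u *\<^sub>R e) = norm (s *\<^sub>R x0 + (- u) *\<^sub>R e)"
      by (rule power2_eq_imp_eq) (simp_all only: norm_sq power2_minus norm_ge_zero)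
  qed (simp add: inner_add_right inner_diff_right e(2))
  have hA: "?h (s *\<^sub>R x0 + u *\<^sub>R e) = poly A s" if "s\<^sup>2 + u\<^sup>2 = 1" for s u
    using A(2)[of s u] A(2)[of s "- u"] flip[of s u] that by simp
  have even: "poly A (- s) = poly A s" if "\<bar>s\<bar> \<le> 1" for s
  proof -
    define u where "u = sqrt (1 - s\<^sup>2)"
    have "s\<^sup>2 \<le> 1" using that by (simp add: abs_square_le_1)
    then have u: "s\<^sup>2 + u\<^sup>2 = 1" by (simp add: u_def)
    have "- (s *\<^sub>R x0 + u *\<^sub>R e) = (- s) *\<^sub>R x0 + (- u) *\<^sub>R e" by simp
    then have "?h ((- s) *\<^sub>R x0 + (- u) *\<^sub>R e) = ?h (s *\<^sub>R x0 + u *\<^sub>R e)" using V_even[OF hV] by metis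
    then show ?thesis using hA[of s u] hA[of "- s" "- u"] u by simp
  qed
  have main: "kernel x y = poly A ((x \<bullet> y) / r\<^sup>2)" if x: "x \<in> X" "norm x = r" and y: "norm y = r" for x y
  proof -
    let ?y = "reflection (x - x0) y"
    have sx: "reflection (x - x0) x = x0" using x x0 by (intro reflection_swap) simp
    have K: "kernel x y = ?h ?y" using kernel_reflection[of x "x - x0" y] x x0 sx by simp
    have ip: "x0 \<bullet> ?y = x \<bullet> y" using inner_reflection[of "x - x0" x y] sx by simp
    have ny: "norm ?y = r" using y by (simp add: orthogonal_transformation_norm[OF orthogonal_reflection])
    define s where "s = (x \<bullet> y) / r\<^sup>2"
    define u where "u = sqrt (1 - s\<^sup>2)"
    have "\<bar>x \<bullet> y\<bar> \<le> r\<^sup>2" using Cauchy_Schwarz_ineq2[of x y] x y by (simp add: power2_eq_square)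
    then have "\<bar>s\<bar> \<le> 1" using r by (simp add: s_def abs_divide)
    then have "s\<^sup>2 \<le> 1" by (simp add: abs_square_le_1)
    then have u: "s\<^sup>2 + u\<^sup>2 = 1" by (simp add: u_def)
    have "?h ?y = ?h (s *\<^sub>R x0 + u *\<^sub>R e)"
    proof (rule fixed)
      have "(norm (s *\<^sub>R x0 + u *\<^sub>R e))\<^sup>2 = r\<^sup>2" by (simp only: norm_sq u mult_1)
      then show "norm ?y = norm (s *\<^sub>R x0 + u *\<^sub>R e)" using ny r by simp
      show "x0 \<bullet> ?y = x0 \<bullet> (s *\<^sub>R x0 + u *\<^sub>R e)" using r by (simp add: ip inner_add_right e(2) x0x0 s_def)
    qed
    then show ?thesis using hA[OF u] K by (simp add: s_def)
  qed
  have "poly A 1 > 0" using main[of x0 x0] x0 kernel_self[OF x0(1)] r by (simp add: x0x0)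
  then show ?thesis using that A(1) even main by blast
qed

text \<open>The inner products of non-antipodal points and their negatives are roots of the even polynomial that represents the kernel on the layer.\<close>

lemma card_squared_inner_products:
  assumes r: "r > 0" and d: "CARD('d) \<ge> 2"
  obtains B where "finite B" "card B \<le> k" "1 \<notin> B"
    "\<And>x y. x \<in> X \<Longrightarrow> y \<in> X \<Longrightarrow> norm x = r \<Longrightarrow> norm y = r \<Longrightarrow> x \<noteq> y \<Longrightarrow> x \<noteq> - y \<Longrightarrow> ((x \<bullet> y) / r\<^sup>2)\<^sup>2 \<in> B"
proof (cases "\<exists>x0\<in>X. norm x0 = r")
  case False
  then show ?thesis using that[of "{}"] by auto
next
  case True
  then obtain x0 where x0: "x0 \<in> X" "norm x0 = r" by blast
  obtain A where A: "degree A \<le> 2 * k" "poly A 1 > 0"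
    "\<And>s. \<bar>s\<bar> \<le> 1 \<Longrightarrow> poly A (- s) = poly A s"
    "\<And>x y. x \<in> X \<Longrightarrow> norm x = r \<Longrightarrow> norm y = r \<Longrightarrow> kernel x y = poly A ((x \<bullet> y) / r\<^sup>2)"
    using kernel_on_layer[OF r x0 d] by metis
  have "A \<noteq> 0" using A(2) by auto
  let ?Z = "{s. \<bar>s\<bar> \<le> 1 \<and> poly A s = 0}"
  have fin: "finite ?Z" by (rule finite_subset[OF _ poly_roots_finite[OF \<open>A \<noteq> 0\<close>]]) auto
  have "card ?Z \<le> card {s. poly A s = 0}" by (intro card_mono poly_roots_finite \<open>A \<noteq> 0\<close>) auto
  then have "card ?Z \<le> 2 * k" using card_poly_roots_bound[OF \<open>A \<noteq> 0\<close>] A(1) by linarith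
  then have card: "card ((\<lambda>z. z\<^sup>2) ` ?Z) \<le> k"
    using A(3) by (intro card_squares_of_symmetric_set fin) auto
  show ?thesis
  proof (rule that[of "(\<lambda>z. z\<^sup>2) ` ?Z"])
    show "finite ((\<lambda>z. z\<^sup>2) ` ?Z)" "card ((\<lambda>z. z\<^sup>2) ` ?Z) \<le> k" using fin card by auto
    show "1 \<notin> (\<lambda>z. z\<^sup>2) ` ?Z"
    proof
      assume "1 \<in> (\<lambda>z. z\<^sup>2) ` ?Z"
      then obtain z where "z\<^sup>2 = 1" "poly A z = 0" by auto
      then show False using A(2) A(3)[of 1] by (auto simp: power2_eq_1_iff)
    qed
    fix x y assume xy: "x \<in> X" "y \<in> X" "norm x = r" "norm y = r" "x \<noteq> y" "x \<noteq> - y"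
    have "kernel x y = 0" using xy by (intro kernel_zero) auto
    then have "poly A ((x \<bullet> y) / r\<^sup>2) = 0" using A(4)[OF xy(1,3,4)] by simp
    moreover have "\<bar>x \<bullet> y\<bar> \<le> r\<^sup>2" using Cauchy_Schwarz_ineq2[of x y] xy by (simp add: power2_eq_square)
    then have "\<bar>(x \<bullet> y) / r\<^sup>2\<bar> \<le> 1" using r by (simp add: abs_divide)
    ultimately show "((x \<bullet> y) / r\<^sup>2)\<^sup>2 \<in> (\<lambda>z. z\<^sup>2) ` ?Z" by blast
  qed
qed

text \<open>A generic \<open>u\<close> selects one point of each antipodal pair. These \<open>N - 1\<close> points are distributed over at most \<open>k\<close>
  layers, so one layer contains more than \<open>2 * D\<close> of them.\<close>

lemma rational_layer:
  assumes d: "CARD('d) \<ge> 2" and k: "k \<ge> 1"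
    and D: "card {m :: 'd \<Rightarrow> nat. sum m UNIV = 2 * k - 1} \<le> D"
      "card {m :: 'd \<Rightarrow> nat. sum m UNIV = 2 * (k - 1)} \<le> D" "k * (2 * D) < N - 1"
  shows "\<exists>r L. is_layer X r L \<and> (\<forall>\<alpha>\<in>inner_products r L. \<alpha> \<in> \<rat>)"
proof -
  obtain u where u: "\<And>a. a \<in> X - {0} \<Longrightarrow> u \<bullet> a \<noteq> 0"
    using vector_avoiding_hyperplanes[of "X - {0}"] finite_X by auto
  define H where "H = {x \<in> X. u \<bullet> x > 0}"
  have finH: "finite H" using finite_X by (simp add: H_def)
  have anti: "- x \<in> X" if "x \<in> X" for x
    using antipodal_delta(1)[OF that] origin by (cases "x = 0") auto
  have "X = insert 0 (H \<union> uminus ` H)"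
  proof (intro equalityI subsetI)
    fix x assume x: "x \<in> X"
    consider "x = 0" | "u \<bullet> x > 0" | "u \<bullet> (- x) > 0" using u[of x] x by fastforce
    then show "x \<in> insert 0 (H \<union> uminus ` H)"
    proof cases
      case 3
      then have "- x \<in> H" using anti[OF x] by (simp add: H_def)
      then have "- (- x) \<in> uminus ` H" by (rule imageI)
      then show ?thesis by simp
    qed (use x in \<open>auto simp: H_def\<close>)
  qed (use origin anti in \<open>auto simp: H_def\<close>)
  moreover have "0 \<notin> H \<union> uminus ` H" by (auto simp: H_def)
  moreover have "H \<inter> uminus ` H = {}" by (auto simp: H_def)
  moreover have "card (uminus ` H) = card H" by (rule card_image) simp
  ultimately have "card X = Suc (2 * card H)" using finH by (simp add: card_Un_disjoint)
  then have cardH: "card H = N - 1" using card_X by simp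
  have "\<exists>r\<in>norm ` H. card {x \<in> H. norm x = r} > 2 * D"
  proof (rule ccontr)
    assume "\<not> ?thesis"
    then have le: "card {x \<in> H. norm x = r} \<le> 2 * D" if "r \<in> norm ` H" for r using that by force
    have "H = (\<Union>r\<in>norm ` H. {x \<in> H. norm x = r})" by auto
    then have "card H \<le> (\<Sum>r\<in>norm ` H. card {x \<in> H. norm x = r})"
      using card_UN_le[of "norm ` H" "\<lambda>r. {x \<in> H. norm x = r}"] finH by simp
    also have "\<dots> \<le> (\<Sum>r\<in>norm ` H. 2 * D)" by (intro sum_mono le)
    also have "\<dots> = card (norm ` H) * (2 * D)" by simp
    also have "card (norm ` H) \<le> card (norm ` (X - {0}))"
      using finite_X by (intro card_mono) (auto simp: H_def)
    then have "card (norm ` H) * (2 * D) \<le> k * (2 * D)" using card_radii by (intro mult_right_mono) auto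
    finally show False using D(3) cardH by simp
  qed
  then obtain r where r: "r \<in> norm ` H" "card {x \<in> H. norm x = r} > 2 * D" by blast
  define Y where "Y = {x \<in> H. norm x = r}"
  have "r > 0" using r(1) by (auto simp: H_def)
  obtain B where B: "finite B" "card B \<le> k" "1 \<notin> B"
    "\<And>x y. x \<in> X \<Longrightarrow> y \<in> X \<Longrightarrow> norm x = r \<Longrightarrow> norm y = r \<Longrightarrow> x \<noteq> y \<Longrightarrow> x \<noteq> - y \<Longrightarrow> ((x \<bullet> y) / r\<^sup>2)\<^sup>2 \<in> B"
    using card_squared_inner_products[OF \<open>r > 0\<close> d] by metis
  have Y: "finite Y" "Y \<subseteq> sphere 0 r" using finH by (auto simp: Y_def)
  have Y_card: "2 * card {m :: 'd \<Rightarrow> nat. sum m UNIV = 2 * k - 1} < card Y"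
      "2 * card {m :: 'd \<Rightarrow> nat. sum m UNIV = 2 * (k - 1)} < card Y"
    using r(2) D(1,2) by (simp_all add: Y_def)
  have Y_B: "((x \<bullet> y) / r\<^sup>2)\<^sup>2 \<in> B" if "x \<in> Y" "y \<in> Y" "x \<noteq> y" for x y
  proof (rule B(4))
    show "x \<noteq> - y"
    proof
      assume "x = - y"
      then have "u \<bullet> x = - (u \<bullet> y)" by simp
      then show False using that(1,2) by (simp add: Y_def H_def)
    qed
  qed (use that in \<open>simp_all add: Y_def H_def\<close>)
  have Y_rational: "(x \<bullet> y) / r\<^sup>2 \<in> \<rat>" if "x \<in> Y" "y \<in> Y" "x \<noteq> y" for x y
    by (rule few_squared_inner_products_rational[OF Y \<open>r > 0\<close> k Y_card B(1-3) _ that]) (rule Y_B)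
  let ?L = "X \<inter> sphere 0 r"
  have half: "x \<in> Y \<or> - x \<in> Y" if "x \<in> ?L" for x
  proof -
    have "x \<noteq> 0" using that \<open>r > 0\<close> by auto
    then have "u \<bullet> x \<noteq> 0" using u that by blast
    then show ?thesis using that anti[of x] by (auto simp: Y_def H_def)
  qed
  have "\<alpha> \<in> \<rat>" if \<alpha>: "\<alpha> \<in> inner_products r ?L" for \<alpha>
  proof -
    obtain x y where xy: "\<alpha> = (x \<bullet> y) / r\<^sup>2" "x \<in> ?L" "y \<in> ?L" "x \<noteq> y"
      using \<alpha> unfolding inner_products_def by blast
    show ?thesis
    proof (cases "x = - y")
      case True
      have "y \<bullet> y = r\<^sup>2" using xy(3) by (auto simp: power2_norm_eq_inner[symmetric])
      then have "\<alpha> = - 1" using True xy(1) \<open>r > 0\<close> by simp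
      then show ?thesis by simp
    next
      case False
      define x' where "x' = (if x \<in> Y then x else - x)"
      define y' where "y' = (if y \<in> Y then y else - y)"
      have "x' \<in> Y" "y' \<in> Y" using half xy(2,3) by (auto simp: x'_def y'_def)
      moreover have "x' \<noteq> y'" using False xy(4) by (auto simp: x'_def y'_def)
      ultimately have rat: "(x' \<bullet> y') / r\<^sup>2 \<in> \<rat>" by (rule Y_rational)
      have "\<alpha> = (x' \<bullet> y') / r\<^sup>2 \<or> \<alpha> = - ((x' \<bullet> y') / r\<^sup>2)"
        by (auto simp: xy(1) x'_def y'_def)
      then show ?thesis using rat Rats_minus_iff by metis
    qed
  qed
  moreover have "is_layer X r ?L" using r(1) \<open>r > 0\<close> by (auto simp: is_layer_def H_def)
  ultimately show ?thesis by blast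
qed

end

section \<open>Rational inner products\<close>

theorem theorem3p5:
  fixes k :: nat
    and p :: real and q :: ereal and W :: "real \<Rightarrow> real"
    and X :: "(real ^ 'd) set" and w :: "real ^ 'd \<Rightarrow> real"
  assumes "k \<ge> 2"
    and "int CARD('d) \<ge> 4 * (int k)\<^sup>2 - 2 * int k + 1"
    and "0 \<le> p" and "ereal p < q"
    and "\<And>r. p \<le> r \<Longrightarrow> ereal r < q \<Longrightarrow> W r > 0"
    and "\<And>j. j \<le> 4 * k \<Longrightarrow>
           interval_lebesgue_integrable lebesgue (ereal p) q
             (\<lambda>r. r ^ j * r ^ (CARD('d) - 1) * W r)"
    and "minimal_cubature p q W k X w"
  shows "\<exists>r L. is_layer X r L \<and> (\<forall>\<alpha>\<in>inner_products r L. \<alpha> \<in> \<rat>)"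
proof -
  define N where "N = real_fun.dim (even_polys_on (annulus p q :: (real ^ 'd) set) (2 * k))"
  define D where "D = (\<lambda>n. card {m :: 'd \<Rightarrow> nat. sum m UNIV = n})"
  have min: "finite X" "\<And>x. x \<in> X \<Longrightarrow> w x > 0" "0 \<in> X" "int (card X) = 2 * int N - 1"
    and cub: "\<And>f. f \<in> polys_upto (4 * k + 1) \<Longrightarrow> radial_integral p q W f = (\<Sum>x\<in>X. w x * f x)"
    using assms(7) by (auto simp: minimal_cubature_def cubature_formula_def N_def)
  have N: "D (2 * k) + 2 \<le> N"
    using card_even_monomials_gt[OF assms(1), where 'd = 'd] card_even_monomials_le_dim[OF assms(3,4), of "2 * k", where 'd = 'd]
    by (simp add: D_def N_def)
  have d: "CARD('d) \<ge> 4 * k\<^sup>2 - 2 * k + 1"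
  proof -
    have "int (4 * k\<^sup>2 - 2 * k + 1) = 4 * (int k)\<^sup>2 - 2 * int k + 1"
      using assms(1) by (simp add: of_nat_diff power2_eq_square)
    then show ?thesis using assms(2) by linarith
  qed
  have "2 * k + 2 \<le> 4 * k\<^sup>2" 
  proof -
    have "2 * k + 2 \<le> 4 * k" using assms(1) by simp
    also have "4 * k \<le> 4 * k\<^sup>2" by (simp add: power2_eq_square)
    finally show ?thesis .
  qed
  then have d2: "CARD('d) \<ge> 2" using d by linarith
  interpret tight_formula X w k N
  proof
    show "finite X" "0 \<in> X" "\<And>x. x \<in> X \<Longrightarrow> w x > 0" using min by auto
    show "(\<Sum>x\<in>X. w x * f x) = 0" if "f \<in> polys_upto (4 * k + 1)" "\<And>x. f (- x) = - f x" for f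
      using radial_integral_odd[OF that] cub[OF that(1)] by simp
    show "(\<Sum>x\<in>X. w x * f (g x)) = (\<Sum>x\<in>X. w x * f x)"
      if f: "f \<in> polys_upto (4 * k)" and g: "orthogonal_transformation g" for f g
    proof -
      have f': "f \<in> polys_upto (4 * k + 1)" using f by (rule polys_upto_mono) simp
      moreover have "(\<lambda>x. f (g x)) \<in> polys_upto (4 * k + 1)"
        using f' orthogonal_transformation_linear[OF g] by (rule polys_upto_compose_linear)
      ultimately show ?thesis using radial_integral_isometry[OF f' g] cub by metis
    qed
    show "f x = 0" if f: "f \<in> polys_upto (2 * k)" and zero: "(\<Sum>x\<in>X. w x * (f x * f x)) = 0" for f x
    proof (rule radial_integral_square_eq_0[OF f assms(3,4,5)])
      have "(\<lambda>x. f x * f x) \<in> polys_upto (4 * k + 1)"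
        by (rule polys_upto_mono[OF polys_upto_mult[OF f f]]) simp
      then show "radial_integral p q W (\<lambda>x. f x * f x) = 0" using cub zero by simp
    qed (use assms(6) in auto)
    show "dim_ge N (even_polys (2 * k) :: (real ^ 'd \<Rightarrow> real) set)"
      unfolding N_def by (rule dim_ge_even_polys)
    show "card X + 1 = 2 * N" using min(4) by linarith
    show "1 < N" using N by simp
  qed
  show ?thesis
  proof (rule rational_layer[OF d2, of "D (2 * k - 1)"])
    show "1 \<le> k" using assms(1) by simp
    show "card {m :: 'd \<Rightarrow> nat. sum m UNIV = 2 * k - 1} \<le> D (2 * k - 1)" by (simp add: D_def)
    show "card {m :: 'd \<Rightarrow> nat. sum m UNIV = 2 * (k - 1)} \<le> D (2 * k - 1)"
      using card_monomials_grow(2)[OF assms(1) d] by (simp add: D_def)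
    show "k * (2 * D (2 * k - 1)) < N - 1"
      using card_monomials_grow(1)[OF assms(1) d] N by (simp add: D_def)
  qed
qed

end
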